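(* Let $V$ be a finite-dimensional irreducible $U_q(\widehat{\mathfrak{sl}}_2)$-module of type $(\varepsilon_0,\varepsilon_1)$, and let $\alpha\in\mathbb F$ be nonzero. Then there exists a unique $U^{\geq0}$-module structure on $V$ such that the operators $e_0^+-R$, $e_1^+-L$, $K_0^{\pm1}-\varepsilon_0\alpha^{\mp1}K^{\pm1}$ and $K_1^{\pm1}-\varepsilon_1\alpha^{\pm1}K^{\mp1}$ vanish on $V$ (that is, $e_0^+=R$, $e_1^+=L$, $K_0=\varepsilon_0\alpha^{-1}K$, $K_0^{-1}=\varepsilon_0\alpha K^{-1}$, $K_1=\varepsilon_1\alpha K^{-1}$, $K_1^{-1}=\varepsilon_1\alpha^{-1}K$ as operators on $V$). This $U^{\geq0}$-module structure is irreducible and of type $\alpha$.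
   Context: $\mathbb F$ is an algebraically closed field, and $q\in\mathbb F$ is nonzero and not a root of unity. $[n]=\frac{q^n-q^{-n}}{q-q^{-1}}$. $U_q(\widehat{\mathfrak{sl}}_2)$ is the unital associative $\mathbb F$-algebra with generators $e_i^{\pm},K_i^{\pm1}$ ($i\in\{0,1\}$) and relations: $K_iK_i^{-1}=K_i^{-1}K_i=1$; $K_0K_1=K_1K_0$; $K_ie_i^{\pm}K_i^{-1}=q^{\pm2}e_i^{\pm}$; $K_ie_j^{\pm}K_i^{-1}=q^{\mp2}e_j^{\pm}$ for $i\ne j$; $[e_i^+,e_i^-]=\frac{K_i-K_i^{-1}}{q-q^{-1}}$; $[e_0^{\pm},e_1^{\mp}]=0$; $(e_i^{\pm})^3e_j^{\pm}-[3](e_i^{\pm})^2e_j^{\pm}e_i^{\pm}+[3]e_i^{\pm}e_j^{\pm}(e_i^{\pm})^2-e_j^{\pm}(e_i^{\pm})^3=0$ for $i\neq j$. (Here $[x,y]=xy-yx$ for algebra elements.) $U^{\geq0}$ is the unital associative $\mathbb F$-algebra with generators $R,L,K^{\pm1}$ and relations: $KK^{-1}=K^{-1}K=1$; $KRK^{-1}=q^2R$; $KLK^{-1}=q^{-2}L$; $R^3L-[3]R^2LR+[3]RLR^2-LR^3=0$; $L^3R-[3]L^2RL+[3]LRL^2-RL^3=0$. Type of a $U^{\geq0}$-module: on any finite-dimensional irreducible $U^{\geq0}$-module $V$, $K$ acts semisimply and there are a unique integer $d\ge0$ and a unique nonzero $\alpha\in\mathbb F$ such that the set of distinct eigenvalues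 of $K$ on $V$ is $\{\alpha q^{2i-d}\mid 0\le i\le d\}$; $\alpha$ is called the type of $V$. Type of a $U_q(\widehat{\mathfrak{sl}}_2)$-module: on any finite-dimensional irreducible $U_q(\widehat{\mathfrak{sl}}_2)$-module $V$, it is known that $K_0,K_1$ act semisimply and there are an integer $d\ge0$ and $\varepsilon_0,\varepsilon_1\in\{1,-1\}$ such that the set of distinct eigenvalues of $K_0$ on $V$ is $\{\varepsilon_0q^{2i-d}\mid 0\le i\le d\}$ and $K_0K_1-\varepsilon_0\varepsilon_1I$ vanishes on $V$; the pair $(\varepsilon_0,\varepsilon_1)$ is called the type of $V$. (If $\mathbb F$ has characteristic 2, $\{1,-1\}$ is viewed as having a single element.) *)

theory Defs
  imports
    "HOL-Library.Poly_Mapping"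
    "HOL-Computational_Algebra.Polynomial"
    "HOL-Algebra.QuotRing"
    "HOL-Algebra.Algebraic_Closure_Type"
begin

section \<open>Algebras given by generators and relations\<close>

text \<open>
  The free monoid on \<open>'g\<close> is wrapped in a type of its own, written additively, so that the
  convolution product on \<^type>\<open>poly_mapping\<close> makes \<open>'g free_monoid \<Rightarrow>\<^sub>0 'a\<close> the free unital
  associative algebra over \<open>'a\<close> with generating set \<open>'g\<close>.
\<close>

datatype 'g free_monoid = Word "'g list"

instantiation free_monoid :: (type) monoid_add
begin

definition zero_free_monoid :: "'g free_monoid" where
  "zero_free_monoid = Word []"

fun plus_free_monoid :: "'g free_monoid \<Rightarrow> 'g free_monoid \<Rightarrow> 'g free_monoid" where
  "plus_free_monoid (Word u) (Word v) = Word (u @ v)"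

instance
proof
  fix a b c :: "'g free_monoid"
  show "a + b + c = a + (b + c)"
    by (cases a; cases b; cases c) simp
  show "0 + a = a" "a + 0 = a"
    by (cases a; simp add: zero_free_monoid_def)+
qed

end

type_synonym ('g, 'a) free_algebra = "'g free_monoid \<Rightarrow>\<^sub>0 'a"

definition gen :: "'g \<Rightarrow> ('g, 'a::field) free_algebra" where
  "gen g = Poly_Mapping.single (Word [g]) 1"

definition const :: "'a::field \<Rightarrow> ('g, 'a) free_algebra" where
  "const c = Poly_Mapping.single 0 c"

text \<open>
  A relation \<open>l = r\<close> is represented by the element \<open>l - r\<close>.  The operator \<open>Idl\<close> generates
  two-sided ideals here, since \<^locale>\<open>ideal\<close> does not presuppose commutativity.
\<close>

definition presented_algebra ::
  "('g, 'a::field) free_algebra set \<Rightarrow> ('g, 'a) free_algebra set ring" where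
  "presented_algebra rels = ring_of_type_algebra Quot (Idl\<^bsub>ring_of_type_algebra\<^esub> rels)"

definition residue_class ::
  "('g, 'a::field) free_algebra set \<Rightarrow> ('g, 'a) free_algebra \<Rightarrow> ('g, 'a) free_algebra set" where
  "residue_class rels x = (Idl\<^bsub>ring_of_type_algebra\<^esub> rels) +>\<^bsub>ring_of_type_algebra\<^esub> x"


section \<open>Modules over a presented algebra\<close>

text \<open>The vector space is the whole type \<open>'v\<close> with scalar multiplication \<open>scale\<close>.\<close>

definition End_ring :: "('a::field \<Rightarrow> 'v::ab_group_add \<Rightarrow> 'v) \<Rightarrow> ('v \<Rightarrow> 'v) ring" where
  "End_ring scale =
     \<lparr>carrier = {f. Vector_Spaces.linear scale scale f},
      monoid.mult = (\<circ>), one = id, zero = (\<lambda>v. 0), add = (\<lambda>f g v. f v + g v)\<rparr>"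

text \<open>
  A module structure on the given vector space is an algebra homomorphism \<open>\<rho>\<close> from the algebra
  to the endomorphism algebra; the last conjunct makes the ring homomorphism \<open>'a\<close>-linear.
  Extensionality fixes the irrelevant values of \<open>\<rho>\<close> outside the carrier of the algebra, so that
  equality of functions is equality of module structures.
\<close>

definition module_structure ::
  "('a::field \<Rightarrow> 'v::ab_group_add \<Rightarrow> 'v) \<Rightarrow> ('g, 'a) free_algebra set
     \<Rightarrow> (('g, 'a) free_algebra set \<Rightarrow> 'v \<Rightarrow> 'v) \<Rightarrow> bool" where
  "module_structure scale rels \<rho> \<longleftrightarrow>
     \<rho> \<in> ring_hom (presented_algebra rels) (End_ring scale) \<and>
     \<rho> \<in> extensional (carrier (presented_algebra rels)) \<and>
     (\<forall>c. \<rho> (residue_class rels (const c)) = scale c)"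

definition irreducible_module ::
  "('a::field \<Rightarrow> 'v::ab_group_add \<Rightarrow> 'v) \<Rightarrow> ('g, 'a) free_algebra set
     \<Rightarrow> (('g, 'a) free_algebra set \<Rightarrow> 'v \<Rightarrow> 'v) \<Rightarrow> bool" where
  "irreducible_module scale rels \<rho> \<longleftrightarrow>
     module_structure scale rels \<rho> \<and> (UNIV :: 'v set) \<noteq> {0} \<and>
     (\<forall>W. module.subspace scale W \<and> (\<forall>x \<in> carrier (presented_algebra rels). \<rho> x ` W \<subseteq> W)
        \<longrightarrow> W = {0} \<or> W = UNIV)"

definition eigenvalues :: "('a::field \<Rightarrow> 'v::ab_group_add \<Rightarrow> 'v) \<Rightarrow> ('v \<Rightarrow> 'v) \<Rightarrow> 'a set" where
  "eigenvalues scale f = {c. \<exists>v. v \<noteq> 0 \<and> f v = scale c v}"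


section \<open>The quantum affine algebra and its Borel subalgebra\<close>

definition qint :: "'a::field \<Rightarrow> int \<Rightarrow> 'a" where
  "qint q n = (q powi n - q powi (- n)) / (q - inverse q)"

definition q_serre :: "'a::field \<Rightarrow> ('g, 'a) free_algebra \<Rightarrow> ('g, 'a) free_algebra
    \<Rightarrow> ('g, 'a) free_algebra" where
  "q_serre q x y =
     x ^ 3 * y - const (qint q 3) * x ^ 2 * y * x + const (qint q 3) * x * y * x ^ 2 - y * x ^ 3"

definition commutator :: "'r::ring \<Rightarrow> 'r \<Rightarrow> 'r" where
  "commutator x y = x * y - y * x"

datatype node = N0 | N1

datatype sgn = Plus | Minus

fun opp :: "sgn \<Rightarrow> sgn" where
  "opp Plus = Minus"
| "opp Minus = Plus"

fun sgn_int :: "sgn \<Rightarrow> int" where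
  "sgn_int Plus = 1"
| "sgn_int Minus = - 1"

text \<open>With the sign \<open>s\<close> read as an exponent, \<open>GenE s i\<close> is $e_i^s$, \<open>GenK s i\<close> is $K_i^{s 1}$ and \<open>BorelK s\<close> is $K^{s 1}$.\<close>

datatype uq_gen = GenE sgn node | GenK sgn node

datatype borel_gen = BorelR | BorelL | BorelK sgn

abbreviation E :: "sgn \<Rightarrow> node \<Rightarrow> (uq_gen, 'a::field) free_algebra" where
  "E s i \<equiv> gen (GenE s i)"

abbreviation K :: "sgn \<Rightarrow> node \<Rightarrow> (uq_gen, 'a::field) free_algebra" where
  "K s i \<equiv> gen (GenK s i)"

abbreviation bR :: "(borel_gen, 'a::field) free_algebra" where
  "bR \<equiv> gen BorelR"

abbreviation bL :: "(borel_gen, 'a::field) free_algebra" where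
  "bL \<equiv> gen BorelL"

abbreviation bK :: "sgn \<Rightarrow> (borel_gen, 'a::field) free_algebra" where
  "bK s \<equiv> gen (BorelK s)"

definition uq_rels :: "'a::field \<Rightarrow> (uq_gen, 'a) free_algebra set" where
  "uq_rels q =
     {K Plus i * K Minus i - 1 | i. True} \<union>
     {K Minus i * K Plus i - 1 | i. True} \<union>
     {K Plus N0 * K Plus N1 - K Plus N1 * K Plus N0} \<union>
     {K Plus i * E s i * K Minus i - const (q powi (2 * sgn_int s)) * E s i | s i. True} \<union>
     {K Plus i * E s j * K Minus i - const (q powi (- 2 * sgn_int s)) * E s j | s i j. i \<noteq> j} \<union>
     {commutator (E Plus i) (E Minus i) - const (1 / (q - inverse q)) * (K Plus i - K Minus i)
        | i. True} \<union>
     {commutator (E s N0) (E (opp s) N1) | s. True} \<union>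
     {q_serre q (E s i) (E s j) | s i j. i \<noteq> j}"

definition borel_rels :: "'a::field \<Rightarrow> (borel_gen, 'a) free_algebra set" where
  "borel_rels q =
     {bK Plus * bK Minus - 1, bK Minus * bK Plus - 1,
      bK Plus * bR * bK Minus - const (q powi 2) * bR,
      bK Plus * bL * bK Minus - const (q powi (- 2)) * bL,
      q_serre q bR bL, q_serre q bL bR}"

abbreviation uq_op ::
  "'a::field \<Rightarrow> ((uq_gen, 'a) free_algebra set \<Rightarrow> 'v \<Rightarrow> 'v) \<Rightarrow> (uq_gen, 'a) free_algebra \<Rightarrow> 'v \<Rightarrow> 'v"
  where "uq_op q \<rho> x \<equiv> \<rho> (residue_class (uq_rels q) x)"

abbreviation borel_op ::
  "'a::field \<Rightarrow> ((borel_gen, 'a) free_algebra set \<Rightarrow> 'v \<Rightarrow> 'v) \<Rightarrow> (borel_gen, 'a) free_algebra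
     \<Rightarrow> 'v \<Rightarrow> 'v"
  where "borel_op q \<sigma> x \<equiv> \<sigma> (residue_class (borel_rels q) x)"

text \<open>
  The two predicates below are meant for finite-dimensional irreducible modules.  Semisimplicity
  of the \<open>K\<close>-operators and existence (and uniqueness) of the type are theorems about such modules
  and hence not part of the definitions.
\<close>

definition uq_type ::
  "('a::field \<Rightarrow> 'v::ab_group_add \<Rightarrow> 'v) \<Rightarrow> 'a \<Rightarrow> ((uq_gen, 'a) free_algebra set \<Rightarrow> 'v \<Rightarrow> 'v)
     \<Rightarrow> 'a \<times> 'a \<Rightarrow> bool" where
  "uq_type scale q \<rho> = (\<lambda>(\<epsilon>0, \<epsilon>1).
     \<epsilon>0 \<in> {1, - 1} \<and> \<epsilon>1 \<in> {1, - 1} \<and>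
     (\<exists>d::nat. eigenvalues scale (uq_op q \<rho> (K Plus N0)) =
        {\<epsilon>0 * q powi (2 * int i - int d) | i. i \<le> d}) \<and>
     uq_op q \<rho> (K Plus N0 * K Plus N1 - const (\<epsilon>0 * \<epsilon>1)) = (\<lambda>v. 0))"

definition borel_type ::
  "('a::field \<Rightarrow> 'v::ab_group_add \<Rightarrow> 'v) \<Rightarrow> 'a \<Rightarrow> ((borel_gen, 'a) free_algebra set \<Rightarrow> 'v \<Rightarrow> 'v)
     \<Rightarrow> 'a \<Rightarrow> bool" where
  "borel_type scale q \<sigma> \<alpha> \<longleftrightarrow>
     \<alpha> \<noteq> 0 \<and>
     (\<exists>d::nat. eigenvalues scale (borel_op q \<sigma> (bK Plus)) =
        {\<alpha> * q powi (2 * int i - int d) | i. i \<le> d})"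

text \<open>
  The operators $e_0^+-R$, $e_1^+-L$, $K_0^{\pm1}-\varepsilon_0\alpha^{\mp1}K^{\pm1}$ and
  $K_1^{\pm1}-\varepsilon_1\alpha^{\pm1}K^{\mp1}$ vanish on the common underlying space.
\<close>

definition compatible ::
  "('a::field \<Rightarrow> 'v::ab_group_add \<Rightarrow> 'v) \<Rightarrow> 'a \<Rightarrow> 'a \<Rightarrow> 'a \<Rightarrow> 'a
     \<Rightarrow> ((uq_gen, 'a) free_algebra set \<Rightarrow> 'v \<Rightarrow> 'v)
     \<Rightarrow> ((borel_gen, 'a) free_algebra set \<Rightarrow> 'v \<Rightarrow> 'v) \<Rightarrow> bool" where
  "compatible scale q \<epsilon>0 \<epsilon>1 \<alpha> \<rho> \<sigma> \<longleftrightarrow> (\<forall>v.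
     uq_op q \<rho> (E Plus N0) v - borel_op q \<sigma> bR v = 0 \<and>
     uq_op q \<rho> (E Plus N1) v - borel_op q \<sigma> bL v = 0 \<and>
     (\<forall>s. uq_op q \<rho> (K s N0) v
            - scale (\<epsilon>0 * \<alpha> powi (- sgn_int s)) (borel_op q \<sigma> (bK s) v) = 0) \<and>
     (\<forall>s. uq_op q \<rho> (K s N1) v
            - scale (\<epsilon>1 * \<alpha> powi (sgn_int s)) (borel_op q \<sigma> (bK (opp s)) v) = 0))"

end

theory Submission
  imports Defs
begin

text \<open>
  \<^bold>\<open>Existence and uniqueness.\<close>  Compatibility prescribes the operators of all Borel generators:
  \<open>R = e\<^sub>0\<^sup>+\<close>, \<open>L = e\<^sub>1\<^sup>+\<close> and \<open>K = \<epsilon>0 \<alpha> K\<^sub>0\<close> (\<open>compatible_iff\<close>).  A module structure is determined by the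
  generators (\<open>module_structure_eqI\<close>), and the prescribed operators satisfy the Borel relations because
  these are among the relations of the quantum affine algebra, the scalar \<open>\<epsilon>0 \<alpha>\<close> cancelling in
  \<open>K x K\<inverse>\<close>.  The universal property \<open>module_structure_exists\<close> then gives the structure.
  Its type is \<open>\<alpha>\<close> since multiplication by \<open>\<epsilon>0 \<alpha>\<close> turns the eigenvalues of \<open>K\<^sub>0\<close> into those of \<open>K\<close>.

  \<^bold>\<open>Irreducibility.\<close>  Let \<open>W\<close> be a subspace stable under \<open>e\<^sub>0\<^sup>+\<close>, \<open>e\<^sub>1\<^sup>+\<close> and \<open>K\<^sub>0\<^sup>\<plusminus>\<^sup>1\<close>.  The \<open>K\<^sub>0\<close>-weight
  spaces span an invariant subspace, hence everything, so \<open>W\<close> is the sum of its weight parts.  By the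
  representation theory of quantum sl(2), the \<open>r\<close>-th power of \<open>e\<^sub>0\<^sup>+\<close> is injective from weight \<open>- r\<close> to
  weight \<open>r\<close>, and that of \<open>e\<^sub>1\<^sup>+\<close> is injective in the opposite direction.  By finite-dimensionality both
  restrict to bijections between the weight parts of \<open>W\<close>.  A subspace stable under a raising operator,
  with this bijectivity, is also stable under the lowering operator (\<open>graded_sl2.f_invariant\<close>): a vector
  of weight \<open>- r \<le> 0\<close> in \<open>W\<close> differs by the raising of a vector of \<open>W\<close> from one killed by the power
  \<open>r + 1\<close> of the raising operator, and such a vector is killed by the lowering operator.  Thus \<open>W\<close> is
  stable under \<open>e\<^sub>0\<^sup>-\<close> and \<open>e\<^sub>1\<^sup>-\<close> too, hence a submodule (\<open>borel_invariant_subspace_trivial\<close>).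

  The facts about quantum sl(2) are obtained from the Casimir element (\<open>graded_sl2.e_pow_eq_0\<close>)
  without decomposing modules into irreducible ones.
\<close>

section \<open>Representations of free algebras\<close>

lemma update_eq_single_plus:
  assumes "a \<notin> Poly_Mapping.keys f"
  shows "Poly_Mapping.update a b f = Poly_Mapping.single a b + f"
  using assms
  by (intro poly_mapping_eqI)
     (auto simp: lookup_add lookup_single lookup_update when_def in_keys_iff)

lemma free_algebra_induct [case_names const gen add mult]:
  fixes x :: "('g, 'a::field) free_algebra"
  assumes const: "\<And>c. P (const c)"
    and gen: "\<And>g. P (gen g)"
    and add: "\<And>x y. P x \<Longrightarrow> P y \<Longrightarrow> P (x + y)"
    and mult: "\<And>x y. P x \<Longrightarrow> P y \<Longrightarrow> P (x * y)"
  shows "P x"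
proof -
  have word: "P (Poly_Mapping.single (Word l) c)" for l and c :: 'a
  proof (induction l arbitrary: c)
    case Nil
    show ?case
      using const[of c] by (simp add: const_def zero_free_monoid_def)
  next
    case (Cons g l)
    have "gen g * Poly_Mapping.single (Word l) c = Poly_Mapping.single (Word (g # l)) c"
      by (simp add: gen_def mult_single)
    then show ?case
      using mult[OF gen[of g] Cons.IH[of c]] by simp
  qed
  show ?thesis
  proof (induction x rule: Poly_Mapping.update_induct)
    case const
    show ?case
      using assms(1)[of 0] by (simp add: const_def)
  next
    case (update f a b)
    have "P (Poly_Mapping.single a b)"
      using word by (cases a) auto
    then show ?case
      using add update(1,3) by (simp add: update_eq_single_plus)
  qed
qed

text \<open>
  A unital algebra homomorphism from a free algebra to the endomorphisms of a vector space,
  described pointwise.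
\<close>

locale free_algebra_rep = vector_space scale
  for scale :: "'a::field \<Rightarrow> 'v::ab_group_add \<Rightarrow> 'v" +
  fixes h :: "('g, 'a) free_algebra \<Rightarrow> 'v \<Rightarrow> 'v"
  assumes linear_rep: "Vector_Spaces.linear scale scale (h x)"
    and rep_add: "h (x + y) v = h x v + h y v"
    and rep_mult: "h (x * y) v = h x (h y v)"
    and rep_const: "h (const c) v = scale c v"
begin

lemma const_1: "(const 1 :: ('g, 'a) free_algebra) = 1"
  by (simp add: const_def)

lemma const_0: "(const 0 :: ('g, 'a) free_algebra) = 0"
  by (simp add: const_def)

lemma rep_one: "h 1 v = v"
  using rep_const[of 1] by (simp add: const_1)

lemma rep_zero: "h 0 v = 0"
  using rep_const[of 0] by (simp add: const_0)

lemma rep_diff: "h (x - y) v = h x v - h y v"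
  using rep_add[of "x - y" y v] by simp

lemma rep_power: "h (x ^ n) v = (h x ^^ n) v"
  by (induction n arbitrary: v) (simp_all add: rep_one rep_mult)

lemma arg_add: "h x (v + w) = h x v + h x w"
  and arg_scale: "h x (scale c v) = scale c (h x v)"
  using linear_rep[of x] by (simp_all add: Vector_Spaces.linear_iff)

lemmas rep_simps = rep_add rep_mult rep_const rep_one rep_zero rep_diff rep_power

lemma rep_invariant:
  assumes W: "subspace W" and gen: "\<And>g v. v \<in> W \<Longrightarrow> h (gen g) v \<in> W" and "v \<in> W"
  shows "h x v \<in> W"
  using \<open>v \<in> W\<close>
proof (induction x arbitrary: v rule: free_algebra_induct)
  case (const c)
  then show ?case
    using W by (simp add: rep_const subspace_scale)
qed (use W gen in \<open>simp_all add: rep_add rep_mult subspace_add\<close>)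

end

lemma free_algebra_rep_eqI:
  assumes "free_algebra_rep scale h" "free_algebra_rep scale h'"
    and gen: "\<And>g v. h (gen g) v = h' (gen g) v"
  shows "h x v = h' x v"
proof -
  interpret h: free_algebra_rep scale h by fact
  interpret h': free_algebra_rep scale h' by fact
  show ?thesis
    by (induction x arbitrary: v rule: free_algebra_induct)
       (simp_all add: gen h.rep_simps h'.rep_simps)
qed

text \<open>
  A word acts as the product of the operators \<open>T g\<close> of its letters in the order written, so its last
  letter acts first.
\<close>

definition word_op :: "('g \<Rightarrow> 'v \<Rightarrow> 'v) \<Rightarrow> 'g free_monoid \<Rightarrow> 'v \<Rightarrow> 'v" where
  "word_op T w v = (case w of Word l \<Rightarrow> foldr T l v)"

text \<open>
  The extension of \<open>T\<close> to the free algebra: \<open>x\<close> acts as the linear combination of the operators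
  of its words.  Summing over \<open>keys x\<close> makes the sum finite.
\<close>

definition free_eval ::
  "('a::field \<Rightarrow> 'v::ab_group_add \<Rightarrow> 'v) \<Rightarrow> ('g \<Rightarrow> 'v \<Rightarrow> 'v) \<Rightarrow> ('g, 'a) free_algebra \<Rightarrow> 'v \<Rightarrow> 'v"
  where "free_eval scale T x v =
    (\<Sum>w \<in> Poly_Mapping.keys x. scale (Poly_Mapping.lookup x w) (word_op T w v))"

lemma word_op_zero: "word_op T 0 v = v"
  by (simp add: word_op_def zero_free_monoid_def)

lemma word_op_plus: "word_op T (u + w) v = word_op T u (word_op T w v)"
  by (cases u; cases w) (simp add: word_op_def)

context
  fixes scale :: "'a::field \<Rightarrow> 'v::ab_group_add \<Rightarrow> 'v" and T :: "'g \<Rightarrow> 'v \<Rightarrow> 'v"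
  assumes T: "\<And>g. Vector_Spaces.linear scale scale (T g)"
begin

interpretation vector_space scale
  using T[of undefined] by (simp add: Vector_Spaces.linear_iff)

lemma word_op_linear:
  "word_op T w (v + v') = word_op T w v + word_op T w v'"
  "word_op T w (scale c v) = scale c (word_op T w v)"
proof -
  obtain l where w: "w = Word l" by (cases w)
  have "foldr T l (v + v') = foldr T l v + foldr T l v'"
    "foldr T l (scale c v) = scale c (foldr T l v)"
    using T by (induction l) (simp_all add: Vector_Spaces.linear_iff)
  then show "word_op T w (v + v') = word_op T w v + word_op T w v'"
    "word_op T w (scale c v) = scale c (word_op T w v)"
    by (simp_all add: word_op_def w)
qed

lemma free_eval_superset:
  assumes "finite A" "Poly_Mapping.keys x \<subseteq> A"
  shows "free_eval scale T x v = (\<Sum>w\<in>A. scale (Poly_Mapping.lookup x w) (word_op T w v))"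
  unfolding free_eval_def using assms
  by (intro sum.mono_neutral_left) (auto simp: in_keys_iff)

lemma free_eval_add: "free_eval scale T (x + y) v = free_eval scale T x v + free_eval scale T y v"
proof -
  let ?A = "Poly_Mapping.keys x \<union> Poly_Mapping.keys y"
  have "Poly_Mapping.keys (x + y) \<subseteq> ?A" by (rule Poly_Mapping.keys_add)
  then show ?thesis
    by (simp add: free_eval_superset[of ?A] lookup_add scale_left_distrib sum.distrib)
qed

lemma free_eval_single: "free_eval scale T (Poly_Mapping.single w c) v = scale c (word_op T w v)"
  by (simp add: free_eval_superset[of "{w}"])

lemma free_eval_linear: "Vector_Spaces.linear scale scale (free_eval scale T x)"
proof -
  have "free_eval scale T x (u + v) = free_eval scale T x u + free_eval scale T x v"
    "free_eval scale T x (scale c v) = scale c (free_eval scale T x v)" for u v c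
    unfolding free_eval_def word_op_linear scale_right_distrib scale_sum_right sum.distrib
    by (simp_all add: mult.commute)
  then show ?thesis
    using vector_space_axioms by (simp add: Vector_Spaces.linear_iff)
qed

lemma free_eval_gen: "free_eval scale T (gen g) v = T g v"
  by (simp add: gen_def free_eval_single word_op_def)

lemma free_eval_mult: "free_eval scale T (x * y) v = free_eval scale T x (free_eval scale T y v)"
proof -
  have arg: "free_eval scale T z (u + u') = free_eval scale T z u + free_eval scale T z u'"
    "free_eval scale T z 0 = 0" for z u u'
    using free_eval_linear[of z] module_hom.zero[of scale scale "free_eval scale T z"]
    by (auto simp: Vector_Spaces.linear_iff module_hom_iff_linear)
  have zero: "free_eval scale T 0 u = 0" for u
    by (simp add: free_eval_def)
  have single: "free_eval scale T (Poly_Mapping.single w c * y) v =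
      free_eval scale T (Poly_Mapping.single w c) (free_eval scale T y v)" for w c
  proof (induction y rule: Poly_Mapping.update_induct)
    case const
    then show ?case by (simp add: zero arg)
  next
    case (update f a b)
    then show ?case
      by (simp add: update_eq_single_plus distrib_left free_eval_add arg mult_single
          free_eval_single word_op_plus word_op_linear)
  qed
  show ?thesis
  proof (induction x rule: Poly_Mapping.update_induct)
    case const
    then show ?case by (simp add: zero)
  next
    case (update f a b)
    then show ?case
      by (simp add: update_eq_single_plus distrib_right free_eval_add single)
  qed
qed

lemma free_eval_rep: "free_algebra_rep scale (free_eval scale T)"
  using vector_space_axioms
  by (intro free_algebra_rep.intro free_algebra_rep_axioms.intro)
     (simp_all add: free_eval_linear free_eval_add free_eval_mult const_def free_eval_single
       word_op_zero)

end


section \<open>Module structures from operators satisfying the relations\<close>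

lemma ring_ring_of_type_algebra: "ring (ring_of_type_algebra :: 'r::ring_1 ring)"
proof -
  have "\<exists>y. x + y = 0" for x :: 'r
    using add.right_inverse by blast
  then show ?thesis
    unfolding ring_of_type_algebra_def using add.right_inverse
    by unfold_locales (auto simp: algebra_simps Units_def)
qed

context
  fixes rels :: "('g, 'a::field) free_algebra set"
begin

private abbreviation (input) F :: "('g, 'a) free_algebra ring" where
  "F \<equiv> ring_of_type_algebra"

interpretation F: ring F by (rule ring_ring_of_type_algebra)

lemma carrier_type_ring: "carrier F = UNIV"
  by (simp add: ring_of_type_algebra_def)

interpretation I: ideal "Idl\<^bsub>F\<^esub> rels" F
  by (rule F.genideal_ideal) (simp add: carrier_type_ring)

lemma residue_class_in_carrier: "residue_class rels x \<in> carrier (presented_algebra rels)"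
  using I.rcos_ring_hom[THEN ring_hom_closed, of x]
  by (simp add: residue_class_def presented_algebra_def carrier_type_ring)

lemma carrier_presented_algebraE:
  assumes "A \<in> carrier (presented_algebra rels)"
  obtains x where "A = residue_class rels x"
proof -
  have "A \<in> {Idl\<^bsub>F\<^esub> rels +>\<^bsub>F\<^esub> x | x. x \<in> carrier F}"
    using assms unfolding presented_algebra_def FactRing_def A_RCOSETS_def RCOSETS_def a_r_coset_def
    by auto
  then show ?thesis
    using that unfolding residue_class_def by blast
qed

lemma residue_class_hom:
  "residue_class rels (x + y) = residue_class rels x \<oplus>\<^bsub>presented_algebra rels\<^esub> residue_class rels y"
  "residue_class rels (x * y) = residue_class rels x \<otimes>\<^bsub>presented_algebra rels\<^esub> residue_class rels y"
  "residue_class rels 1 = \<one>\<^bsub>presented_algebra rels\<^esub>"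
  using I.rcos_ring_hom[THEN ring_hom_add, of x y] I.rcos_ring_hom[THEN ring_hom_mult, of x y]
    I.rcos_ring_hom[THEN ring_hom_one]
  unfolding residue_class_def presented_algebra_def
  by (simp_all add: carrier_type_ring) (simp_all add: ring_of_type_algebra_def)

lemma minus_type_ring: "x \<ominus>\<^bsub>F\<^esub> y = x - y"
proof -
  have "\<ominus>\<^bsub>F\<^esub> y = - y"
  proof (rule F.minus_equality)
    show "- y \<oplus>\<^bsub>F\<^esub> y = \<zero>\<^bsub>F\<^esub>"
      unfolding ring_of_type_algebra_def by simp
  qed (simp_all add: carrier_type_ring)
  then show ?thesis
    unfolding a_minus_def by simp (simp add: ring_of_type_algebra_def)
qed

lemma residue_class_eq_iff:
  "residue_class rels x = residue_class rels y \<longleftrightarrow> x - y \<in> Idl\<^bsub>F\<^esub> rels"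
  using F.quotient_eq_iff_same_a_r_cos[OF I.ideal_axioms, of x y]
  by (simp add: residue_class_def carrier_type_ring minus_type_ring)

lemma residue_class_relation: "r \<in> rels \<Longrightarrow> residue_class rels r = residue_class rels 0"
  using F.genideal_self[of rels] by (auto simp: residue_class_eq_iff carrier_type_ring)

text \<open>
  The kernel of a representation is a two-sided ideal, so it contains the ideal generated by
  the relations as soon as it contains the relations.
\<close>

lemma rep_vanishes_on_ideal:
  assumes "free_algebra_rep scale h" and rels: "\<And>r v. r \<in> rels \<Longrightarrow> h r v = 0"
    and x: "x \<in> Idl\<^bsub>F\<^esub> rels"
  shows "h x v = 0"
proof -
  interpret free_algebra_rep scale h by fact
  have arg_zero: "h y 0 = 0" for y
    using arg_scale[of y 0 0] by simp
  let ?J = "{y. \<forall>v. h y v = 0}"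
  have "ideal ?J F"
  proof (rule idealI[OF F.ring_axioms])
    show "subgroup ?J (add_monoid F)"
    proof (rule F.add.subgroupI)
      fix y assume "y \<in> ?J"
      moreover have "\<ominus>\<^bsub>F\<^esub> y = 0 - y"
        using minus_type_ring[of 0 y] by (simp add: a_minus_def ring_of_type_algebra_def)
      ultimately show "\<ominus>\<^bsub>F\<^esub> y \<in> ?J"
        by (simp only: rep_diff rep_zero mem_Collect_eq) simp
    qed (auto simp: ring_of_type_algebra_def rep_simps intro: exI[of _ 0])
  qed (simp_all add: ring_of_type_algebra_def rep_simps arg_zero)
  then have "Idl\<^bsub>F\<^esub> rels \<subseteq> ?J"
    using rels by (intro F.genideal_minimal) auto
  then show ?thesis
    using x by blast
qed

lemma module_structure_rep:
  assumes "vector_space scale" and "module_structure scale rels \<sigma>"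
  shows "free_algebra_rep scale (\<lambda>x. \<sigma> (residue_class rels x))"
proof -
  have hom: "\<sigma> \<in> ring_hom (presented_algebra rels) (End_ring scale)"
    and const: "\<And>c. \<sigma> (residue_class rels (const c)) = scale c"
    using assms(2) by (simp_all add: module_structure_def)
  show ?thesis
  proof (intro free_algebra_rep.intro free_algebra_rep_axioms.intro assms(1))
    fix x y v
    show "Vector_Spaces.linear scale scale (\<sigma> (residue_class rels x))"
      using ring_hom_closed[OF hom residue_class_in_carrier, of x] by (simp add: End_ring_def)
    show "\<sigma> (residue_class rels (x + y)) v = \<sigma> (residue_class rels x) v + \<sigma> (residue_class rels y) v"
      using ring_hom_add[OF hom residue_class_in_carrier residue_class_in_carrier, of x y]
      by (simp add: residue_class_hom End_ring_def)
    show "\<sigma> (residue_class rels (x * y)) v = \<sigma> (residue_class rels x) (\<sigma> (residue_class rels y) v)"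
      using ring_hom_mult[OF hom residue_class_in_carrier residue_class_in_carrier, of x y]
      by (simp add: residue_class_hom End_ring_def)
    show "\<sigma> (residue_class rels (const c)) v = scale c v" for c
      by (simp add: const)
  qed
qed

lemma module_structure_relation:
  assumes "vector_space scale" and "module_structure scale rels \<sigma>" and "r \<in> rels"
  shows "\<sigma> (residue_class rels r) v = 0"
proof -
  interpret free_algebra_rep scale "\<lambda>x. \<sigma> (residue_class rels x)"
    by (rule module_structure_rep[OF assms(1,2)])
  show ?thesis
    using rep_zero by (simp add: residue_class_relation[OF assms(3)])
qed

lemma module_structure_eqI:
  assumes "vector_space scale" "module_structure scale rels \<sigma>" "module_structure scale rels \<tau>"
    and gen: "\<And>g v. \<sigma> (residue_class rels (gen g)) v = \<tau> (residue_class rels (gen g)) v"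
  shows "\<sigma> = \<tau>"
proof (rule extensionalityI)
  show "\<sigma> \<in> extensional (carrier (presented_algebra rels))"
    "\<tau> \<in> extensional (carrier (presented_algebra rels))"
    using assms by (simp_all add: module_structure_def)
  fix A assume "A \<in> carrier (presented_algebra rels)"
  then obtain x where "A = residue_class rels x"
    by (rule carrier_presented_algebraE)
  then show "\<sigma> A = \<tau> A"
    using free_algebra_rep_eqI[OF module_structure_rep module_structure_rep, OF assms(1,2,1,3) gen]
    by auto
qed

text \<open>
  The universal property of a presented algebra: operators that satisfy the defining relations
  come from a module structure.
\<close>

lemma module_structure_exists:
  assumes "vector_space scale" and T: "\<And>g. Vector_Spaces.linear scale scale (T g)"
    and rels: "\<And>r v. r \<in> rels \<Longrightarrow> free_eval scale T r v = 0"
  obtains \<sigma> where "module_structure scale rels \<sigma>"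
    and "\<And>g. \<sigma> (residue_class rels (gen g)) = T g"
proof -
  interpret free_algebra_rep scale "free_eval scale T"
    by (rule free_eval_rep[OF T])
  \<comment> \<open>The value on a residue class does not depend on the representative chosen by \<open>SOME\<close>.\<close>
  define \<sigma> where "\<sigma> = (\<lambda>A \<in> carrier (presented_algebra rels).
    free_eval scale T (SOME x. A = residue_class rels x))"
  have \<sigma>: "\<sigma> (residue_class rels x) = free_eval scale T x" for x
  proof
    fix v
    let ?y = "SOME y. residue_class rels x = residue_class rels y"
    have "residue_class rels x = residue_class rels ?y"
      by (rule someI[of _ x]) simp
    then have "free_eval scale T (x - ?y) v = 0"
      using rep_vanishes_on_ideal[OF free_algebra_rep_axioms rels]
      by (simp add: residue_class_eq_iff)
    then show "\<sigma> (residue_class rels x) v = free_eval scale T x v"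
      by (simp add: \<sigma>_def residue_class_in_carrier rep_diff)
  qed
  have "\<sigma> \<in> ring_hom (presented_algebra rels) (End_ring scale)"
  proof (rule ring_hom_memI)
    fix A B
    assume A: "A \<in> carrier (presented_algebra rels)" and B: "B \<in> carrier (presented_algebra rels)"
    obtain x y where xy: "A = residue_class rels x" "B = residue_class rels y"
      using A B by (metis carrier_presented_algebraE)
    show "\<sigma> A \<in> carrier (End_ring scale)"
      by (simp add: xy \<sigma> End_ring_def linear_rep)
    show "\<sigma> (A \<otimes>\<^bsub>presented_algebra rels\<^esub> B) = \<sigma> A \<otimes>\<^bsub>End_ring scale\<^esub> \<sigma> B"
      by (simp add: xy \<sigma> End_ring_def rep_mult fun_eq_iff flip: residue_class_hom)
    show "\<sigma> (A \<oplus>\<^bsub>presented_algebra rels\<^esub> B) = \<sigma> A \<oplus>\<^bsub>End_ring scale\<^esub> \<sigma> B"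
      by (simp add: xy \<sigma> End_ring_def rep_add fun_eq_iff flip: residue_class_hom)
  next
    show "\<sigma> \<one>\<^bsub>presented_algebra rels\<^esub> = \<one>\<^bsub>End_ring scale\<^esub>"
      by (simp add: \<sigma> End_ring_def rep_one fun_eq_iff flip: residue_class_hom)
  qed
  then have "module_structure scale rels \<sigma>"
    by (simp add: module_structure_def \<sigma> rep_const fun_eq_iff) (simp add: \<sigma>_def)
  moreover have "\<sigma> (residue_class rels (gen g)) = T g" for g
    by (simp add: \<sigma> fun_eq_iff free_eval_gen[OF T])
  ultimately show ?thesis
    by (rule that)
qed

end


section \<open>Graded representations of quantum sl(2)\<close>

lemma powi_eq_iff_of_not_root_of_unity:
  fixes q :: "'a::field"
  assumes "q \<noteq> 0" and not_root: "\<And>n::nat. n > 0 \<Longrightarrow> q ^ n \<noteq> 1"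
  shows "q powi m = q powi n \<longleftrightarrow> m = n"
proof -
  have *: "k = 0" if "q powi k = 1" for k
  proof (rule ccontr)
    assume "k \<noteq> 0"
    show False
    proof (cases "k > 0")
      case True
      then show False
        using that not_root[of "nat k"] by (simp add: power_int_def)
    next
      case False
      then show False
        using that not_root[of "nat (- k)"] \<open>k \<noteq> 0\<close>
        by (simp add: power_int_def power_inverse)
    qed
  qed
  show ?thesis
    using *[of "m - n"] \<open>q \<noteq> 0\<close> by (auto simp: power_int_diff)
qed

text \<open>
  The raising and lowering operators of quantum sl(2) on a space with weight spaces \<open>U m\<close>.  The
  operator \<open>K\<close> is replaced by the grading: on \<open>U m\<close> it acts as \<open>q\<^sup>m\<close>, so that \<open>[e, f]\<close> acts as the
  quantum integer \<open>[m]\<close>.  A sign in the eigenvalues of \<open>K\<close> is to be absorbed into \<open>f\<close>.  Of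
  finite-dimensionality only the absence of weights below \<open>- d\<close> is kept.
\<close>

locale graded_sl2 = vector_space scale
  for scale :: "'a::field \<Rightarrow> 'v::ab_group_add \<Rightarrow> 'v" +
  fixes q :: 'a and U :: "int \<Rightarrow> 'v set" and e f :: "'v \<Rightarrow> 'v" and d :: int
  assumes q_nonzero: "q \<noteq> 0"
    and not_root_of_unity: "\<And>n::nat. n > 0 \<Longrightarrow> q ^ n \<noteq> 1"
    and linear_e: "Vector_Spaces.linear scale scale e"
    and linear_f: "Vector_Spaces.linear scale scale f"
    and subspace_U: "subspace (U m)"
    and e_U: "v \<in> U m \<Longrightarrow> e v \<in> U (m + 2)"
    and f_U: "v \<in> U m \<Longrightarrow> f v \<in> U (m - 2)"
    and e_f: "v \<in> U m \<Longrightarrow> e (f v) - f (e v) = scale (qint q m) v"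
    and bounded: "m < - d \<Longrightarrow> v \<in> U m \<Longrightarrow> v = 0"
begin

lemma q_powi_eq_iff: "q powi m = q powi n \<longleftrightarrow> m = n"
  by (rule powi_eq_iff_of_not_root_of_unity[OF q_nonzero]) (rule not_root_of_unity)

lemma q_minus_inverse: "q - inverse q \<noteq> 0"
proof
  assume "q - inverse q = 0"
  then have "q powi 1 = q powi - 1"
    by (simp add: power_int_minus)
  then show False
    unfolding q_powi_eq_iff by simp
qed

lemma e_add: "e (v + w) = e v + e w" and e_scale: "e (scale c v) = scale c (e v)"
  and f_add: "f (v + w) = f v + f w" and f_scale: "f (scale c v) = scale c (f v)"
  using linear_e linear_f by (simp_all add: Vector_Spaces.linear_iff)

lemma e_diff: "e (v - w) = e v - e w"
  using e_add[of "v - w" w] by simp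

lemma f_diff: "f (v - w) = f v - f w"
  using f_add[of "v - w" w] by simp

lemma e_zero: "e 0 = 0" and f_zero: "f 0 = 0"
  using e_add[of 0 0] f_add[of 0 0] by simp_all

lemma e_pow_add: "(e ^^ n) (v + w) = (e ^^ n) v + (e ^^ n) w"
  and e_pow_diff: "(e ^^ n) (v - w) = (e ^^ n) v - (e ^^ n) w"
  and e_pow_scale: "(e ^^ n) (scale c v) = scale c ((e ^^ n) v)"
  by (induction n) (simp_all add: e_add e_diff e_scale)

lemma e_pow_zero: "(e ^^ n) 0 = 0"
  by (induction n) (simp_all add: e_zero)

lemma e_pow_U: "v \<in> U m \<Longrightarrow> (e ^^ n) v \<in> U (m + 2 * int n)"
proof (induction n)
  case (Suc n)
  then show ?case
    using e_U[of "(e ^^ n) v" "m + 2 * int n"] by (simp add: algebra_simps)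
qed simp

lemma f_pow_U: "v \<in> U m \<Longrightarrow> (f ^^ n) v \<in> U (m - 2 * int n)"
proof (induction n)
  case (Suc n)
  then show ?case
    using f_U[of "(f ^^ n) v" "m - 2 * int n"] by (simp add: algebra_simps)
qed simp

lemma U_scale: "v \<in> U m \<Longrightarrow> scale c v \<in> U m"
  and U_add: "v \<in> U m \<Longrightarrow> w \<in> U m \<Longrightarrow> v + w \<in> U m"
  and U_diff: "v \<in> U m \<Longrightarrow> w \<in> U m \<Longrightarrow> v - w \<in> U m"
  using subspace_U[of m] by (simp_all add: subspace_scale subspace_add subspace_diff)

text \<open>The value of the Casimir element on a highest weight vector of weight \<open>m\<close>.\<close>

definition cas_val :: "int \<Rightarrow> 'a" where
  "cas_val m = (q powi (m + 1) + q powi (- m - 1)) / (q - inverse q)\<^sup>2"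

lemma cas_val_diff: "cas_val m - cas_val (m - 2) = qint q m"
proof -
  have 1: "q powi (m + 1) = q powi m * q" "q powi (m - 1) = q powi m * inverse q"
    "q powi (- m - 1) = q powi (- m) * inverse q" "q powi (1 - m) = q powi (- m) * q"
    using q_nonzero by (simp_all add: power_int_add power_int_diff power_int_minus field_simps)
  have "cas_val m - cas_val (m - 2) =
      ((q powi (m + 1) + q powi (- m - 1)) - (q powi (m - 1) + q powi (1 - m))) / (q - inverse q)\<^sup>2"
    by (simp add: cas_val_def diff_divide_distrib)
  also have "(q powi (m + 1) + q powi (- m - 1)) - (q powi (m - 1) + q powi (1 - m)) =
      (q powi m - q powi (- m)) * (q - inverse q)"
    by (simp only: 1) (simp add: algebra_simps)
  also have "\<dots> / (q - inverse q)\<^sup>2 = qint q m"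
    using q_minus_inverse by (simp add: qint_def power2_eq_square)
  finally show ?thesis .
qed

lemma cas_val_eq_iff: "cas_val m = cas_val n \<longleftrightarrow> m = n \<or> m = - n - 2"
proof
  assume "cas_val m = cas_val n"
  then have eq: "q powi (m + 1) + q powi (- m - 1) = q powi (n + 1) + q powi (- n - 1)"
    using q_minus_inverse by (simp add: cas_val_def)
  have inv: "q powi (- k - 1) = inverse (q powi (k + 1))" for k
    by (metis power_int_minus minus_add_distrib add_uminus_conv_diff)
  define a b where "a = q powi (m + 1)" and "b = q powi (n + 1)"
  have ab: "a \<noteq> 0" "b \<noteq> 0"
    using q_nonzero by (simp_all add: a_def b_def)
  have "a + inverse a = b + inverse b"
    using eq unfolding inv a_def b_def .
  then have "(a - b) * (a * b - 1) = 0"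
    using ab by (simp add: field_simps) algebra
  then have "a = b \<or> a * b = 1"
    by simp
  then consider "a = b" | "a = inverse b"
    using ab by (auto simp: nonzero_eq_divide_eq inverse_eq_divide)
  then show "m = n \<or> m = - n - 2"
  proof cases
    case 1
    then show ?thesis by (simp add: a_def b_def q_powi_eq_iff)
  next
    case 2
    then have "q powi (m + 1) = q powi (- n - 1)"
      by (simp add: a_def b_def inv)
    then show ?thesis
      by (simp only: q_powi_eq_iff) simp
  qed
next
  assume "m = n \<or> m = - n - 2"
  then show "cas_val m = cas_val n"
  proof
    assume m: "m = - n - 2"
    have "m + 1 = - n - 1" "- m - 1 = n + 1"
      by (simp_all add: m)
    then show ?thesis
      by (simp only: cas_val_def add.commute)
  qed simp
qed

text \<open>
  On \<open>U m\<close> the Casimir element acts as \<open>v \<mapsto> f (e v) + cas_val m \<cdot> v\<close>; the next two lemmas say that it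
  commutes with the powers of \<open>e\<close>.
\<close>

lemma e_casimir:
  assumes "v \<in> U m"
  shows "e (f (e v) + scale (cas_val m) v) = f (e (e v)) + scale (cas_val (m + 2)) (e v)"
proof -
  have "e (f (e v)) = f (e (e v)) + scale (qint q (m + 2)) (e v)"
    using e_f[OF e_U[OF assms]] by (simp add: algebra_simps)
  then show ?thesis
    using cas_val_diff[of "m + 2"]
    by (simp add: e_add e_scale flip: scale_left_distrib) (simp add: algebra_simps)
qed

lemma e_pow_casimir:
  assumes "v \<in> U m"
  shows "(e ^^ n) (f (e v) + scale (cas_val m) v) =
    f (e ((e ^^ n) v)) + scale (cas_val (m + 2 * int n)) ((e ^^ n) v)"
proof (induction n)
  case (Suc n)
  then show ?case
    using e_casimir[OF e_pow_U[OF assms, of n]] by (simp add: algebra_simps)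
qed simp

text \<open>
  A nonzero vector of weight \<open>m\<close> that is killed by \<open>e\<^sup>s\<close> has \<open>m \<ge> 1 - s\<close>, and it is a lowest weight
  vector if \<open>m = 1 - s\<close>.  In the induction step \<open>v\<close> is killed by \<open>e\<^sup>s\<^sup>+\<^sup>1\<close>, so \<open>e\<^sup>s v\<close> is zero or a highest
  weight vector of weight \<open>m + 2 s\<close>.  The Casimir element minus \<open>cas_val (m + 2 s)\<close> therefore sends \<open>v\<close>
  to a vector killed by \<open>e\<^sup>s\<close>, which is zero by the induction hypothesis if \<open>m \<le> - s\<close>.  Then \<open>v\<close> is a
  Casimir eigenvector, \<open>e\<close> undoes \<open>f\<close> up to explicit scalars on its descending string, and these
  scalars vanish only where \<open>cas_val\<close> repeats a value.
\<close>

lemma e_pow_eq_0: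
  assumes "v \<in> U m" "(e ^^ s) v = 0" "v \<noteq> 0"
  shows "m \<ge> 1 - int s \<and> (m = 1 - int s \<longrightarrow> f v = 0)"
  using assms
proof (induction s arbitrary: m v)
  case 0
  then show ?case by simp
next
  case (Suc s)
  note IH = Suc.IH
  have ef: "e (f v) = scale (cas_val (m + 2 * int s) - cas_val (m - 2)) v"
    if v: "v \<in> U m" "(e ^^ Suc s) v = 0" and m: "m \<le> - int s" for v m
  proof -
    let ?c = "cas_val (m + 2 * int s)"
    let ?u = "(f (e v) + scale (cas_val m) v) - scale ?c v"
    have "(e ^^ s) ?u = 0"
      using v(2) by (simp add: e_pow_diff e_pow_scale e_pow_casimir[OF v(1)] f_zero)
    moreover have "?u \<in> U m"
      using f_U[OF e_U[OF v(1)]] by (intro U_diff U_add U_scale v(1)) simp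
    ultimately have "?u = 0"
      using IH[of ?u m] m by force
    then have "f (e v) = scale (?c - cas_val m) v"
      by (simp add: algebra_simps)
    moreover have "e (f v) = f (e v) + scale (qint q m) v"
      using e_f[OF v(1)] by (simp add: algebra_simps)
    ultimately show ?thesis
      by (simp add: cas_val_diff[symmetric] algebra_simps)
  qed
  have bound: "m \<ge> - int s" if v: "v \<in> U m" "(e ^^ Suc s) v = 0" "v \<noteq> 0" for v m
  proof (rule ccontr)
    assume m: "\<not> m \<ge> - int s"
    \<comment> \<open>Otherwise no power of \<open>f\<close> kills the vector, and its string leaves the bounded range.\<close>
    let ?c = "cas_val (m + 2 * int s)"
    have step: "e ((f ^^ Suc t) v) = scale (?c - cas_val (m - 2 * int t - 2)) ((f ^^ t) v)" for t
    proof (induction t)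
      case 0
      show ?case using ef[OF v(1,2)] m by simp
    next
      case (Suc t)
      have "e (f ((f ^^ Suc t) v)) =
          f (e ((f ^^ Suc t) v)) + scale (qint q (m - 2 * int (Suc t))) ((f ^^ Suc t) v)"
        using e_f[OF f_pow_U[OF v(1), of "Suc t"]] by (simp add: algebra_simps)
      also have "f (e ((f ^^ Suc t) v)) = scale (?c - cas_val (m - 2 * int t - 2)) ((f ^^ Suc t) v)"
        by (simp only: Suc.IH f_scale) simp
      also have "scale (?c - cas_val (m - 2 * int t - 2)) ((f ^^ Suc t) v) +
          scale (qint q (m - 2 * int (Suc t))) ((f ^^ Suc t) v) =
          scale (?c - cas_val (m - 2 * int (Suc t) - 2)) ((f ^^ Suc t) v)"
        using cas_val_diff[of "m - 2 * int (Suc t)"]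
        unfolding scale_left_distrib[symmetric] by (simp add: algebra_simps)
      finally show ?case
        by simp
    qed
    have "(f ^^ t) v \<noteq> 0" for t
    proof (induction t)
      case (Suc t)
      have "?c - cas_val (m - 2 * int t - 2) \<noteq> 0"
        using m by (simp add: cas_val_eq_iff)
      then have "e ((f ^^ Suc t) v) \<noteq> 0"
        using Suc.IH by (simp only: step) (simp del: right_minus_eq)
      then show ?case
        using e_zero by metis
    qed (simp add: v)
    moreover have "(f ^^ nat (\<bar>d\<bar> + 1 + \<bar>m\<bar>)) v = 0"
      by (rule bounded[OF _ f_pow_U[OF v(1)]]) simp
    ultimately show False by blast
  qed
  show ?case
  proof (intro conjI impI)
    show "m \<ge> 1 - int (Suc s)"
      using bound[OF Suc.prems] by simp
  next
    assume m: "m = 1 - int (Suc s)"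
    then have "cas_val (m + 2 * int s) = cas_val (m - 2)"
      by (simp add: cas_val_eq_iff)
    then have "e (f v) = 0"
      using ef[OF Suc.prems(1,2)] m by simp
    then have "(e ^^ Suc s) (f v) = 0"
      by (simp only: funpow_Suc_right comp_apply e_pow_zero)
    then show "f v = 0"
      using bound[OF f_U[OF Suc.prems(1)]] m by force
  qed
qed

lemma e_pow_injective: "v \<in> U (- int r) \<Longrightarrow> (e ^^ r) v = 0 \<Longrightarrow> v = 0"
  using e_pow_eq_0[of v "- int r" r] by force

lemma e_pow_Suc_kernel: "v \<in> U (- int r) \<Longrightarrow> (e ^^ Suc r) v = 0 \<Longrightarrow> f v = 0"
  using e_pow_eq_0[of v "- int r" "Suc r"] f_zero by force

text \<open>
  A subspace stable under \<open>e\<close> is stable under \<open>f\<close> on weight vectors, provided \<open>e\<^sup>r\<close> maps its part of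
  weight \<open>- r\<close> onto its part of weight \<open>r\<close>.  This hypothesis cannot be dropped: the line spanned by
  a highest weight vector of positive weight is stable under \<open>e\<close> only.
\<close>

lemma f_invariant:
  assumes W: "subspace W" and eW: "\<And>v. v \<in> W \<Longrightarrow> e v \<in> W"
    and surj: "\<And>r w. w \<in> W \<Longrightarrow> w \<in> U (int r) \<Longrightarrow> \<exists>u \<in> W \<inter> U (- int r). (e ^^ r) u = w"
    and v: "v \<in> W" "v \<in> U m"
  shows "f v \<in> W"
proof -
  have eW': "u \<in> W \<Longrightarrow> (e ^^ n) u \<in> W" for u n
    by (induction n) (simp_all add: eW)
  have f_e: "f (e u) \<in> W" if "u \<in> W" "u \<in> U k" "f u \<in> W" for u k
  proof -
    have "f (e u) = e (f u) - scale (qint q k) u"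
      using e_f[OF that(2)] by (simp add: algebra_simps)
    then show ?thesis
      using that eW W by (simp add: subspace_diff subspace_scale)
  qed
  have nonpos: "f v \<in> W" if "v \<in> W" "v \<in> U (- int r)" for v r
    using that
  proof (induction "nat (d + 1 - int r)" arbitrary: r v rule: less_induct)
    case less
    show ?case
    proof (cases "int r > d")
      case True
      then have "v = 0" using bounded[of "- int r" v] less.prems by simp
      then show ?thesis using W by (simp add: f_zero subspace_0)
    next
      case False
      \<comment> \<open>Subtracting a suitable \<open>e u\<close> leaves a vector killed by \<open>f\<close>, and \<open>u\<close> has smaller weight.\<close>
      have "(e ^^ Suc r) v \<in> W" "(e ^^ Suc r) v \<in> U (int (r + 2))"
        using eW'[OF less.prems(1), of "Suc r"] e_pow_U[OF less.prems(2), of "Suc r"] by (simp_all add: algebra_simps)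
      then obtain u where u: "u \<in> W" "u \<in> U (- int (r + 2))" "(e ^^ (r + 2)) u = (e ^^ Suc r) v"
        using surj by blast
      have eu: "e u \<in> U (- int r)"
        using e_U[OF u(2)] by simp
      have "(e ^^ Suc r) (v - e u) = 0"
        using u(3) by (simp add: e_pow_diff e_diff funpow_swap1)
      then have "f (v - e u) = 0"
        using e_pow_Suc_kernel U_diff[OF less.prems(2) eu] by blast
      then have "f v = f (e u)"
        by (simp add: f_diff)
      moreover have "f u \<in> W"
        using False by (intro less.hyps[OF _ u(1,2)]) simp
      ultimately show ?thesis
        using f_e[OF u(1,2)] by simp
    qed
  qed
  show ?thesis
  proof (cases "m \<le> 0")
    case True
    then show ?thesis
      using nonpos[of v "nat (- m)"] v by simp
  next
    case False
    then obtain r where m: "m = int r"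
      by (metis linear nonneg_int_cases)
    obtain u where u: "u \<in> W" "u \<in> U (- int r)" "(e ^^ r) u = v"
      using surj v m by blast
    have "f ((e ^^ n) u) \<in> W" for n
    proof (induction n)
      case 0
      then show ?case using nonpos u by simp
    next
      case (Suc n)
      then show ?case using f_e eW' e_pow_U u by simp blast
    qed
    then show ?thesis using u(3) by metis
  qed
qed

end


section \<open>Subspaces and weight decompositions\<close>

lemma (in finite_dimensional_vector_space) injective_endomorphism_of_subspace_surj:
  assumes g: "Vector_Spaces.linear scale scale g" and S: "subspace S"
    and gS: "\<And>v. v \<in> S \<Longrightarrow> g v \<in> S" and inj: "\<And>v. v \<in> S \<Longrightarrow> g v = 0 \<Longrightarrow> v = 0"
  shows "g ` S = S"
proof -
  interpret g: Vector_Spaces.linear scale scale g by (rule g)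
  interpret pair: finite_dimensional_vector_space_pair_1 scale Basis scale by unfold_locales
  have "inj_on g S"
    using inj S by (intro inj_onI) (metis g.diff right_minus_eq subspace_diff)
  then have "dim (g ` S) = dim S"
    using S by (intro pair.dim_image_eq g) (simp add: span_eq_iff[THEN iffD2])
  then show ?thesis
    using gS g.subspace_image[OF S] S by (intro subspace_dim_equal) auto
qed

context vector_space
begin

text \<open>
  A subspace stable under \<open>k\<close> that contains a sum of eigenvectors of \<open>k\<close> with distinct eigenvalues
  contains each summand.
\<close>

lemma eigenvector_components_mem:
  assumes k: "Vector_Spaces.linear scale scale k" and W: "subspace W"
    and kW: "\<And>v. v \<in> W \<Longrightarrow> k v \<in> W"
    and "finite A" "inj_on c A"
    and "\<And>m. m \<in> A \<Longrightarrow> k (u m) = scale (c m) (u m)" "(\<Sum>m\<in>A. u m) \<in> W"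
  shows "\<forall>m\<in>A. u m \<in> W"
  using assms(4-)
proof (induction A arbitrary: u rule: finite_induct)
  case empty
  then show ?case by simp
next
  case (insert a A)
  interpret k: Vector_Spaces.linear scale scale k by (rule k)
  let ?s = "\<Sum>m\<in>insert a A. u m"
  have "k ?s = (\<Sum>m\<in>insert a A. scale (c m) (u m))"
    using insert.prems(2) by (simp only: k.sum) (rule sum.cong, simp_all)
  then have "k ?s - scale (c a) ?s = (\<Sum>m\<in>insert a A. scale (c m - c a) (u m))"
    by (simp only: scale_sum_right sum_subtractf[symmetric] scale_left_diff_distrib)
  also have "\<dots> = (\<Sum>m\<in>A. scale (c m - c a) (u m))"
    using insert.hyps by simp
  finally have "(\<Sum>m\<in>A. scale (c m - c a) (u m)) \<in> W"
    using kW insert.prems(3) W by (metis subspace_diff subspace_scale)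
  moreover have "k (scale (c m - c a) (u m)) = scale (c m) (scale (c m - c a) (u m))"
    if "m \<in> A" for m
    using insert.prems(2)[of m] that by (simp add: k.scale mult.commute)
  ultimately have *: "\<forall>m\<in>A. scale (c m - c a) (u m) \<in> W"
    using insert.prems(1) by (intro insert.IH) auto
  have A: "u m \<in> W" if m: "m \<in> A" for m
  proof -
    have ne: "c m - c a \<noteq> 0"
      using insert.prems(1) insert.hyps(2) m by (auto simp: inj_on_def)
    have "scale (inverse (c m - c a)) (scale (c m - c a) (u m)) \<in> W"
      using * m W by (blast intro: subspace_scale)
    then show ?thesis using ne by simp
  qed
  have "?s - (\<Sum>m\<in>A. u m) \<in> W"
    using insert.prems(3) A W by (blast intro: subspace_diff subspace_sum)
  then have "u a \<in> W"
    using insert.hyps by simp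
  then show ?case using A by blast
qed

lemma span_Union_subspaces:
  assumes U: "\<And>m. subspace (U m)" and v: "v \<in> span (\<Union>m. U m)"
  shows "\<exists>A u. finite A \<and> (\<forall>m. u m \<in> U m) \<and> v = (\<Sum>m\<in>A. u m)"
  using v
proof (induction rule: span_induct_alt)
  case base
  show ?case
    using U by (intro exI[of _ "{}"] exI[of _ "\<lambda>_. 0"]) (simp add: subspace_0)
next
  case (step c x y)
  then obtain m A u where m: "x \<in> U m" and A: "finite A" "\<And>n. u n \<in> U n" "y = (\<Sum>n\<in>A. u n)"
    by blast
  define u' where "u' n = (if n = m then scale c x else 0) + (if n \<in> A then u n else 0)" for n
  have "u' n \<in> U n" for n
    using U m A by (auto simp: u'_def intro: subspace_add subspace_scale subspace_0)
  moreover have "(\<Sum>n\<in>insert m A. u' n) = scale c x + y"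
    using A by (simp add: u'_def sum.distrib sum.If_cases insert_absorb)
      (metis (no_types, lifting) Int_absorb1 Int_insert_left subset_insertI)
  ultimately show ?case
    using A(1) by (intro exI[of _ "insert m A"] exI[of _ u']) simp
qed

end


section \<open>Irreducible modules for the quantum affine algebra\<close>

text \<open>A finite-dimensional irreducible module \<open>\<rho>\<close> of type \<open>(\<epsilon>0, \<epsilon>1)\<close>.\<close>

locale uq_irreducible_module = finite_dimensional_vector_space scale B
  for scale :: "'a::field \<Rightarrow> 'v::ab_group_add \<Rightarrow> 'v" and B :: "'v set" +
  fixes q \<epsilon>0 \<epsilon>1 :: 'a and \<rho> :: "(uq_gen, 'a) free_algebra set \<Rightarrow> 'v \<Rightarrow> 'v"
  assumes q_nonzero: "q \<noteq> 0"
    and not_root_of_unity: "\<And>n::nat. n > 0 \<Longrightarrow> q ^ n \<noteq> 1"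
    and irreducible: "irreducible_module scale (uq_rels q) \<rho>"
    and type: "uq_type scale q \<rho> (\<epsilon>0, \<epsilon>1)"
begin

abbreviation act :: "(uq_gen, 'a) free_algebra \<Rightarrow> 'v \<Rightarrow> 'v" where
  "act x \<equiv> uq_op q \<rho> x"

lemma rho_module_structure: "module_structure scale (uq_rels q) \<rho>"
  using irreducible by (simp add: irreducible_module_def)

sublocale rep: free_algebra_rep scale "\<lambda>x. uq_op q \<rho> x"
  by (rule module_structure_rep[OF vector_space_axioms rho_module_structure])

lemma relation: "r \<in> uq_rels q \<Longrightarrow> act r v = 0"
  by (rule module_structure_relation[OF vector_space_axioms rho_module_structure])

lemma \<epsilon>_square: "\<epsilon>0 * \<epsilon>0 = 1" "\<epsilon>1 * \<epsilon>1 = 1"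
  using type by (auto simp: uq_type_def)

lemma \<epsilon>_square': "\<epsilon>0 * (\<epsilon>0 * c) = c" "\<epsilon>1 * (\<epsilon>1 * c) = c"
  using \<epsilon>_square by (metis mult.assoc mult_1)+

lemma K_inverse: "act (K Plus i) (act (K Minus i) v) = v" "act (K Minus i) (act (K Plus i) v) = v"
proof -
  have "K Plus i * K Minus i - 1 \<in> uq_rels q" "K Minus i * K Plus i - 1 \<in> uq_rels q"
    unfolding uq_rels_def by blast+
  from this[THEN relation, of v]
  show "act (K Plus i) (act (K Minus i) v) = v" "act (K Minus i) (act (K Plus i) v) = v"
    by (simp_all add: rep.rep_simps)
qed

lemma K1_eq_K0: "act (K s N1) v = scale (\<epsilon>0 * \<epsilon>1) (act (K (opp s) N0) v)"
proof -
  have K01: "act (K Plus N0) (act (K Plus N1) v) = scale (\<epsilon>0 * \<epsilon>1) v" for v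
    using type unfolding uq_type_def by (simp add: rep.rep_simps fun_eq_iff)
  have plus: "act (K Plus N1) v = scale (\<epsilon>0 * \<epsilon>1) (act (K Minus N0) v)" for v
    using arg_cong[OF K01[of v], of "act (K Minus N0)"] by (simp add: K_inverse rep.arg_scale)
  show ?thesis
  proof (cases s)
    case Plus
    then show ?thesis by (simp add: plus)
  next
    case Minus
    have "act (K Plus N0) v = act (K Plus N0) (act (K Plus N1) (act (K Minus N1) v))"
      by (simp add: K_inverse)
    also have "\<dots> = scale (\<epsilon>0 * \<epsilon>1) (act (K Minus N1) v)"
      by (simp add: K01)
    finally show ?thesis
      by (simp add: Minus \<epsilon>_square \<epsilon>_square' ac_simps)
  qed
qed

lemma K0_E0: "act (K Plus N0) (act (E s N0) v) =
    scale (q powi (2 * sgn_int s)) (act (E s N0) (act (K Plus N0) v))"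
proof -
  have "K Plus N0 * E s N0 * K Minus N0 - const (q powi (2 * sgn_int s)) * E s N0 \<in> uq_rels q"
    unfolding uq_rels_def by blast
  from relation[OF this, of "act (K Plus N0) v"] show ?thesis
    by (simp add: rep.rep_simps K_inverse)
qed

lemma K0_E1: "act (K Plus N0) (act (E s N1) v) =
    scale (q powi (- 2 * sgn_int s)) (act (E s N1) (act (K Plus N0) v))"
proof -
  have "K Plus N0 * E s N1 * K Minus N0 - const (q powi (- 2 * sgn_int s)) * E s N1 \<in> uq_rels q"
    unfolding uq_rels_def by blast
  from relation[OF this, of "act (K Plus N0) v"] show ?thesis
    by (simp add: rep.rep_simps K_inverse)
qed

lemma E_commutator: "act (E Plus i) (act (E Minus i) v) - act (E Minus i) (act (E Plus i) v) =
    scale (1 / (q - inverse q)) (act (K Plus i) v - act (K Minus i) v)"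
proof -
  have "commutator (E Plus i) (E Minus i) - const (1 / (q - inverse q)) * (K Plus i - K Minus i)
      \<in> uq_rels q"
    unfolding uq_rels_def by blast
  from relation[OF this, of v] show ?thesis
    by (simp add: rep.rep_simps commutator_def)
qed

text \<open>Weight spaces are indexed by the exponent of \<open>q\<close> in the eigenvalue of \<open>K\<^sub>0\<close>.\<close>

definition weight_space :: "int \<Rightarrow> 'v set" where
  "weight_space m = {v. act (K Plus N0) v = scale (\<epsilon>0 * q powi m) v}"

lemma subspace_weight_space: "subspace (weight_space m)"
  unfolding subspace_def weight_space_def using rep.arg_scale[of _ 0 0]
  by (auto simp: rep.arg_add rep.arg_scale scale_right_distrib mult.commute)

lemma K0_minus_weight:
  assumes "v \<in> weight_space m"
  shows "act (K Minus N0) v = scale (\<epsilon>0 * q powi (- m)) v"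
proof -
  have "v = act (K Minus N0) (act (K Plus N0) v)"
    by (simp add: K_inverse)
  also have "\<dots> = scale (\<epsilon>0 * q powi m) (act (K Minus N0) v)"
    using assms by (simp add: weight_space_def rep.arg_scale)
  finally have "scale (\<epsilon>0 * q powi (- m)) v =
      scale (\<epsilon>0 * q powi (- m)) (scale (\<epsilon>0 * q powi m) (act (K Minus N0) v))"
    by simp
  also have "\<dots> = act (K Minus N0) v"
    using q_nonzero \<epsilon>_square by (simp add: power_int_minus ac_simps \<epsilon>_square')
  finally show ?thesis by simp
qed

lemma E0_weight: "v \<in> weight_space m \<Longrightarrow> act (E s N0) v \<in> weight_space (m + 2 * sgn_int s)"
  and E1_weight: "v \<in> weight_space m \<Longrightarrow> act (E s N1) v \<in> weight_space (m - 2 * sgn_int s)"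
  using q_nonzero
  by (simp_all add: weight_space_def K0_E0 K0_E1 rep.arg_scale power_int_add power_int_diff
      power_int_minus divide_inverse ac_simps)

lemma E0_commutator_weight:
  assumes "v \<in> weight_space m"
  shows "act (E Plus N0) (act (E Minus N0) v) - act (E Minus N0) (act (E Plus N0) v) =
    scale (\<epsilon>0 * qint q m) v"
  using assms K0_minus_weight[OF assms]
  by (simp add: E_commutator weight_space_def qint_def divide_inverse algebra_simps
      flip: scale_left_diff_distrib)

lemma E1_commutator_weight:
  assumes "v \<in> weight_space m"
  shows "act (E Plus N1) (act (E Minus N1) v) - act (E Minus N1) (act (E Plus N1) v) =
    scale (\<epsilon>1 * qint q (- m)) v"
  using assms K0_minus_weight[OF assms]
  by (simp add: E_commutator K1_eq_K0 weight_space_def qint_def divide_inverse algebra_simps \<epsilon>_square'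
      flip: scale_left_diff_distrib)

lemma q_powi_eq_iff: "q powi m = q powi n \<longleftrightarrow> m = n"
  by (rule powi_eq_iff_of_not_root_of_unity[OF q_nonzero]) (rule not_root_of_unity)

lemma weights_bounded:
  obtains d where "\<And>m v. v \<in> weight_space m \<Longrightarrow> v \<noteq> 0 \<Longrightarrow> - d \<le> m \<and> m \<le> d"
    and "\<exists>v m. v \<in> weight_space m \<and> v \<noteq> 0"
proof -
  obtain d :: nat where d: "eigenvalues scale (act (K Plus N0)) =
      {\<epsilon>0 * q powi (2 * int i - int d) | i. i \<le> d}"
    using type unfolding uq_type_def by blast
  show ?thesis
  proof (rule that[of "int d"])
    fix m v assume "v \<in> weight_space m" "v \<noteq> 0"
    then have "\<epsilon>0 * q powi m \<in> eigenvalues scale (act (K Plus N0))"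
      unfolding eigenvalues_def weight_space_def by blast
    then obtain i where i: "i \<le> d" "\<epsilon>0 * q powi m = \<epsilon>0 * q powi (2 * int i - int d)"
      unfolding d by blast
    have "\<epsilon>0 \<noteq> 0" using \<epsilon>_square by auto
    with i(2) have "m = 2 * int i - int d"
      by (simp add: q_powi_eq_iff)
    then show "- int d \<le> m \<and> m \<le> int d"
      using i(1) by simp
  next
    have "\<epsilon>0 * q powi (2 * int 0 - int d) \<in> eigenvalues scale (act (K Plus N0))"
      unfolding d by blast
    then show "\<exists>v m. v \<in> weight_space m \<and> v \<noteq> 0"
      unfolding eigenvalues_def weight_space_def by blast
  qed
qed

text \<open>
  The operators \<open>K\<^sub>1\<^sup>\<plusminus>\<^sup>1\<close> need no separate hypothesis, because they are scalar multiples of \<open>K\<^sub>0\<^sup>\<mp>\<^sup>1\<close>.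
\<close>

lemma invariant_subspace_trivial:
  assumes W: "subspace W"
    and E: "\<And>s i v. v \<in> W \<Longrightarrow> act (E s i) v \<in> W"
    and K0: "\<And>s v. v \<in> W \<Longrightarrow> act (K s N0) v \<in> W"
  shows "W = {0} \<or> W = UNIV"
proof -
  have "act (gen g) v \<in> W" if "v \<in> W" for g v
  proof (cases g)
    case (GenE s i)
    then show ?thesis using E that by simp
  next
    case (GenK s i)
    then show ?thesis
      using K0 that W by (cases i) (simp_all add: K1_eq_K0 subspace_scale)
  qed
  then have *: "\<rho> (residue_class (uq_rels q) x) ` W \<subseteq> W" for x
    using rep.rep_invariant[OF W] by blast
  have "\<rho> A ` W \<subseteq> W" if "A \<in> carrier (presented_algebra (uq_rels q))" for A
    using that by (rule carrier_presented_algebraE) (simp add: *)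
  then show ?thesis
    using irreducible W unfolding irreducible_module_def by blast
qed

text \<open>The weight spaces span an invariant subspace, hence everything.\<close>

lemma span_weight_spaces: "span (\<Union>m. weight_space m) = UNIV"
proof -
  let ?S = "span (\<Union>m. weight_space m)"
  have inv: "act x v \<in> ?S" if x: "\<And>m v. v \<in> weight_space m \<Longrightarrow> act x v \<in> ?S" and v: "v \<in> ?S" for x v
  proof -
    interpret x: Vector_Spaces.linear scale scale "act x" by (rule rep.linear_rep)
    have "act x ` (\<Union>m. weight_space m) \<subseteq> ?S" using x by blast
    then have "span (act x ` (\<Union>m. weight_space m)) \<subseteq> ?S"
      by (rule span_minimal) (rule subspace_span)
    then show ?thesis
      using v by (auto simp: x.span_image)
  qed
  have E: "act (E s i) v \<in> ?S" if "v \<in> weight_space m" for s i v m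
    using E0_weight[OF that] E1_weight[OF that] by (cases i) (blast intro: span_base)+
  have K: "act (K s N0) v \<in> ?S" if v: "v \<in> weight_space m" for s v m
  proof (cases s)
    case Plus
    have "scale (\<epsilon>0 * q powi m) v \<in> ?S"
      using v by (blast intro: span_base span_scale)
    then show ?thesis using v Plus by (simp add: weight_space_def)
  next
    case Minus
    have "scale (\<epsilon>0 * q powi (- m)) v \<in> ?S"
      using v by (blast intro: span_base span_scale)
    then show ?thesis using K0_minus_weight[OF v] Minus by simp
  qed
  have "?S = {0} \<or> ?S = UNIV"
    by (rule invariant_subspace_trivial) (blast intro: subspace_span inv E K)+
  moreover obtain v m where "v \<in> weight_space m" "v \<noteq> 0"
    using weights_bounded by metis
  then have "?S \<noteq> {0}"
    by (blast intro: span_base)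
  ultimately show ?thesis by blast
qed

text \<open>
  The heart of the theorem.  Both nodes carry quantum sl(2) structures, with \<open>K\<^sub>0\<close>-weights negated for
  the second.  So the powers \<open>e\<^sub>0\<^sup>r\<close> and \<open>e\<^sub>1\<^sup>r\<close> are injective in opposite directions between the parts
  of \<open>W\<close> of weights \<open>- r\<close> and \<open>r\<close>; these parts being finite-dimensional, both powers are bijective
  there, which is what \<open>f_invariant\<close> asks for.
\<close>

lemma borel_invariant_subspace_trivial:
  assumes W: "subspace W"
    and E: "\<And>i v. v \<in> W \<Longrightarrow> act (E Plus i) v \<in> W"
    and K0: "\<And>s v. v \<in> W \<Longrightarrow> act (K s N0) v \<in> W"
  shows "W = {0} \<or> W = UNIV"
proof (rule invariant_subspace_trivial[OF W _ K0])
  obtain d where d: "\<And>m v. v \<in> weight_space m \<Longrightarrow> v \<noteq> 0 \<Longrightarrow> - d \<le> m \<and> m \<le> d"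
    using weights_bounded by metis
  let ?e0 = "act (E Plus N0)" and ?e1 = "act (E Plus N1)"
  let ?f0 = "\<lambda>v. scale \<epsilon>0 (act (E Minus N0) v)" and ?f1 = "\<lambda>v. scale \<epsilon>1 (act (E Minus N1) v)"
  have lin: "Vector_Spaces.linear scale scale (\<lambda>v. scale c (act x v))" for c x
    using rep.linear_rep[of x] vector_space_axioms
    by (simp add: Vector_Spaces.linear_iff scale_right_distrib mult.commute)
  interpret sl0: graded_sl2 scale q weight_space ?e0 ?f0 d
  proof (intro graded_sl2.intro graded_sl2_axioms.intro)
    show "?f0 v \<in> weight_space (m - 2)" if "v \<in> weight_space m" for v m
      using E0_weight[OF that, of Minus] subspace_weight_space by (simp add: subspace_scale)
    show "?e0 (?f0 v) - ?f0 (?e0 v) = scale (qint q m) v" if "v \<in> weight_space m" for v m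
      using arg_cong[OF E0_commutator_weight[OF that], of "scale \<epsilon>0"]
      by (simp add: rep.arg_scale scale_right_diff_distrib \<epsilon>_square')
    show "v = 0" if "m < - d" "v \<in> weight_space m" for m v
      using d[OF that(2)] that(1) by force
  qed (use q_nonzero not_root_of_unity rep.linear_rep lin subspace_weight_space E0_weight[of _ _ Plus]
        vector_space_axioms in simp_all)
  interpret sl1: graded_sl2 scale q "\<lambda>m. weight_space (- m)" ?e1 ?f1 d
  proof (intro graded_sl2.intro graded_sl2_axioms.intro)
    show "?e1 v \<in> weight_space (- (m + 2))" if "v \<in> weight_space (- m)" for v m
      using E1_weight[OF that, of Plus] by simp
    show "?f1 v \<in> weight_space (- (m - 2))" if "v \<in> weight_space (- m)" for v m
      using E1_weight[OF that, of Minus] subspace_weight_space by (simp add: subspace_scale add.commute)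
    show "?e1 (?f1 v) - ?f1 (?e1 v) = scale (qint q m) v" if "v \<in> weight_space (- m)" for v m
      using arg_cong[OF E1_commutator_weight[OF that], of "scale \<epsilon>1"]
      by (simp add: rep.arg_scale scale_right_diff_distrib \<epsilon>_square')
    show "v = 0" if "m < - d" "v \<in> weight_space (- m)" for m v
      using d[OF that(2)] that(1) by force
  qed (use q_nonzero not_root_of_unity rep.linear_rep lin subspace_weight_space
        vector_space_axioms in simp_all)
  have pow_W: "(act (E Plus i) ^^ n) v \<in> W" if "v \<in> W" for i n v
    using that E by (induction n) simp_all
  have pow_lin: "Vector_Spaces.linear scale scale (\<lambda>v. (?e1 ^^ n) ((?e0 ^^ n) v))"
    "Vector_Spaces.linear scale scale (\<lambda>v. (?e0 ^^ n) ((?e1 ^^ n) v))" for n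
    using vector_space_axioms
    by (simp_all add: Vector_Spaces.linear_iff sl0.e_pow_add sl0.e_pow_scale sl1.e_pow_add
        sl1.e_pow_scale)
  have sub: "subspace (W \<inter> weight_space m)" for m
    using W subspace_weight_space by (rule subspace_inter)
  have up: "(?e0 ^^ r) v \<in> weight_space (int r)" if "v \<in> weight_space (- int r)" for r v
    using sl0.e_pow_U[OF that, of r] by simp
  have down: "(?e1 ^^ r) v \<in> weight_space (- int r)" if "v \<in> weight_space (int r)" for r v
    using sl1.e_pow_U[of v "- int r" r] that by simp
  \<comment> \<open>The round trip is injective on a finite-dimensional space, hence onto.\<close>
  have surj0: "\<exists>u \<in> W \<inter> weight_space (- int r). (?e0 ^^ r) u = w"
    if w: "w \<in> W" "w \<in> weight_space (int r)" for r w
  proof -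
    have "(\<lambda>v. (?e0 ^^ r) ((?e1 ^^ r) v)) ` (W \<inter> weight_space (int r)) = W \<inter> weight_space (int r)"
    proof (rule injective_endomorphism_of_subspace_surj[OF pow_lin(2) sub])
      fix v assume v: "v \<in> W \<inter> weight_space (int r)"
      then show "(?e0 ^^ r) ((?e1 ^^ r) v) \<in> W \<inter> weight_space (int r)"
        using pow_W up down by blast
      assume "(?e0 ^^ r) ((?e1 ^^ r) v) = 0"
      then have "(?e1 ^^ r) v = 0"
        using v down sl0.e_pow_injective by blast
      then show "v = 0"
        using v sl1.e_pow_injective[of v r] by simp
    qed
    then obtain v where "v \<in> W \<inter> weight_space (int r)" "w = (?e0 ^^ r) ((?e1 ^^ r) v)"
      using w by blast
    then show ?thesis
      using pow_W down by blast
  qed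
  have surj1: "\<exists>u \<in> W \<inter> weight_space (int r). (?e1 ^^ r) u = w"
    if w: "w \<in> W" "w \<in> weight_space (- int r)" for r w
  proof -
    have "(\<lambda>v. (?e1 ^^ r) ((?e0 ^^ r) v)) ` (W \<inter> weight_space (- int r)) = W \<inter> weight_space (- int r)"
    proof (rule injective_endomorphism_of_subspace_surj[OF pow_lin(1) sub])
      fix v assume v: "v \<in> W \<inter> weight_space (- int r)"
      then show "(?e1 ^^ r) ((?e0 ^^ r) v) \<in> W \<inter> weight_space (- int r)"
        using pow_W up down by blast
      assume "(?e1 ^^ r) ((?e0 ^^ r) v) = 0"
      then have "(?e0 ^^ r) v = 0"
        using v up sl1.e_pow_injective[of "(?e0 ^^ r) v" r] by simp
      then show "v = 0"
        using v sl0.e_pow_injective by blast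
    qed
    then obtain v where "v \<in> W \<inter> weight_space (- int r)" "w = (?e1 ^^ r) ((?e0 ^^ r) v)"
      using w by blast
    then show ?thesis
      using pow_W up by blast
  qed
  have "?f0 v \<in> W" if "v \<in> W" "v \<in> weight_space m" for v m
    using that surj0 by (intro sl0.f_invariant[OF W E]) auto
  moreover have "?f1 v \<in> W" if "v \<in> W" "v \<in> weight_space m" for v m
    using that surj1 by (intro sl1.f_invariant[OF W E, where m = "- m"]) auto
  moreover have "act (E Minus N0) v = scale \<epsilon>0 (?f0 v)" "act (E Minus N1) v = scale \<epsilon>1 (?f1 v)" for v
    by (simp_all add: \<epsilon>_square)
  ultimately have minus: "act (E Minus i) v \<in> W" if "v \<in> W" "v \<in> weight_space m" for v m i
    using that W by (cases i) (metis subspace_scale)+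
  fix s i v assume v: "v \<in> W"
  obtain A u where A: "finite A" "\<And>m. u m \<in> weight_space m" "v = (\<Sum>m\<in>A. u m)"
    using span_Union_subspaces[of weight_space v] subspace_weight_space span_weight_spaces by auto
  have "\<forall>m\<in>A. u m \<in> W"
  proof (rule eigenvector_components_mem[OF rep.linear_rep W K0 A(1)])
    have "\<epsilon>0 \<noteq> 0" using \<epsilon>_square by auto
    then show "inj_on (\<lambda>m. \<epsilon>0 * q powi m) A"
      by (auto simp: inj_on_def q_powi_eq_iff)
    show "act (K Plus N0) (u m) = scale (\<epsilon>0 * q powi m) (u m)" for m
      using A(2)[of m] by (simp add: weight_space_def)
  qed (use v A(3) in simp_all)
  then have sum: "(\<Sum>m\<in>A. act (E Minus i) (u m)) \<in> W"
    using A minus W by (blast intro: subspace_sum)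
  interpret x: Vector_Spaces.linear scale scale "act (E Minus i)" by (rule rep.linear_rep)
  from sum have "act (E Minus i) v \<in> W"
    by (simp add: A(3) x.sum)
  then show "act (E s i) v \<in> W"
    using E[OF v] by (cases s) auto
qed

end


section \<open>The module structure over the Borel subalgebra\<close>

context uq_irreducible_module
begin

context
  fixes \<alpha> :: 'a
  assumes \<alpha>: "\<alpha> \<noteq> 0"
begin

text \<open>
  The operators forced on the Borel generators by compatibility.  Since \<open>\<epsilon>0\<close> is its own inverse,
  \<open>K\<^sub>0 = \<epsilon>0 \<alpha>\<inverse> K\<close> is solved by \<open>K = \<epsilon>0 \<alpha> K\<^sub>0\<close>.
\<close>

definition borel_gen_op :: "borel_gen \<Rightarrow> 'v \<Rightarrow> 'v" where
  "borel_gen_op g = (case g of BorelR \<Rightarrow> act (E Plus N0) | BorelL \<Rightarrow> act (E Plus N1)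
     | BorelK s \<Rightarrow> (\<lambda>v. scale (\<epsilon>0 * \<alpha> powi sgn_int s) (act (K s N0) v)))"

lemma borel_gen_op_linear: "Vector_Spaces.linear scale scale (borel_gen_op g)"
  using rep.linear_rep vector_space_axioms
  by (cases g) (simp_all add: borel_gen_op_def Vector_Spaces.linear_iff scale_right_distrib mult.commute)

lemma sgn_int_opp: "sgn_int (opp s) = - sgn_int s"
  by (cases s) simp_all

text \<open>
  The conditions on \<open>K\<^sub>1\<^sup>\<plusminus>\<^sup>1\<close> impose nothing further, because \<open>K\<^sub>0 K\<^sub>1\<close> acts as \<open>\<epsilon>0 \<epsilon>1\<close>.
\<close>

lemma compatible_iff:
  assumes "module_structure scale (borel_rels q) \<sigma>"
  shows "compatible scale q \<epsilon>0 \<epsilon>1 \<alpha> \<rho> \<sigma> \<longleftrightarrow>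
    (\<forall>g. \<sigma> (residue_class (borel_rels q) (gen g)) = borel_gen_op g)"
proof -
  let ?\<sigma> = "borel_op q \<sigma>"
  have inv: "\<epsilon>0 * \<alpha> powi k * (\<epsilon>0 * \<alpha> powi (- k)) = 1" for k
    using \<alpha> \<epsilon>_square(1) by (simp add: power_int_minus field_simps)
  have K0: "act (K s N0) v = scale (\<epsilon>0 * \<alpha> powi (- sgn_int s)) w \<longleftrightarrow>
      w = borel_gen_op (BorelK s) v" for s v w
  proof
    assume "act (K s N0) v = scale (\<epsilon>0 * \<alpha> powi (- sgn_int s)) w"
    then show "w = borel_gen_op (BorelK s) v"
      using inv[of "sgn_int s"] by (simp add: borel_gen_op_def)
  next
    assume "w = borel_gen_op (BorelK s) v"
    then show "act (K s N0) v = scale (\<epsilon>0 * \<alpha> powi (- sgn_int s)) w"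
      using inv[of "- sgn_int s"] by (simp add: borel_gen_op_def)
  qed
  have K1: "act (K s N1) v = scale (\<epsilon>1 * \<alpha> powi sgn_int s) (borel_gen_op (BorelK (opp s)) v)" for s v
    using \<alpha> by (simp add: borel_gen_op_def K1_eq_K0 sgn_int_opp power_int_minus)
  show ?thesis
  proof
    assume c: "compatible scale q \<epsilon>0 \<epsilon>1 \<alpha> \<rho> \<sigma>"
    show "\<forall>g. ?\<sigma> (gen g) = borel_gen_op g"
    proof (intro allI ext)
      fix g v
      show "?\<sigma> (gen g) v = borel_gen_op g v"
      proof (cases g)
        case (BorelK s)
        have "act (K s N0) v = scale (\<epsilon>0 * \<alpha> powi (- sgn_int s)) (?\<sigma> (bK s) v)"
          using c unfolding compatible_def right_minus_eq by blast
        then show ?thesis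
          unfolding BorelK by (rule K0[THEN iffD1])
      qed (use c in \<open>simp_all add: compatible_def borel_gen_op_def\<close>)
    qed
  next
    assume "\<forall>g. ?\<sigma> (gen g) = borel_gen_op g"
    then show "compatible scale q \<epsilon>0 \<epsilon>1 \<alpha> \<rho> \<sigma>"
      using K0[THEN iffD2, OF refl] K1 unfolding compatible_def right_minus_eq
      by (simp add: borel_gen_op_def)
  qed
qed

lemma compatible_structure_exists:
  "\<exists>\<sigma>. module_structure scale (borel_rels q) \<sigma> \<and> compatible scale q \<epsilon>0 \<epsilon>1 \<alpha> \<rho> \<sigma>"
proof -
  interpret T: free_algebra_rep scale "free_eval scale borel_gen_op"
    by (rule free_eval_rep[OF borel_gen_op_linear])
  have gen: "free_eval scale borel_gen_op bR = act (E Plus N0)"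
    "free_eval scale borel_gen_op bL = act (E Plus N1)"
    "free_eval scale borel_gen_op (bK s) = (\<lambda>v. scale (\<epsilon>0 * \<alpha> powi sgn_int s) (act (K s N0) v))" for s
    by (simp_all add: fun_eq_iff free_eval_gen[OF borel_gen_op_linear] borel_gen_op_def)
  have serre: "act (q_serre q (E Plus i) (E Plus j)) v = 0" if "i \<noteq> j" for i j v
  proof (rule relation)
    show "q_serre q (E Plus i) (E Plus j) \<in> uq_rels q"
      unfolding uq_rels_def using that by blast
  qed
  have cancel: "\<epsilon>0 * \<alpha> * (\<epsilon>0 * inverse \<alpha>) = 1" "\<epsilon>0 * inverse \<alpha> * (\<epsilon>0 * \<alpha>) = 1"
    using \<alpha> \<epsilon>_square(1) by (simp_all add: field_simps)
  have K: "free_eval scale borel_gen_op (bK Plus) = (\<lambda>v. scale (\<epsilon>0 * \<alpha>) (act (K Plus N0) v))"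
    "free_eval scale borel_gen_op (bK Minus) = (\<lambda>v. scale (\<epsilon>0 * inverse \<alpha>) (act (K Minus N0) v))"
    by (simp_all add: gen power_int_minus)
  have conj: "scale (\<epsilon>0 * \<alpha>) (act (K Plus N0) (act x (scale (\<epsilon>0 * inverse \<alpha>) (act (K Minus N0) v)))) =
      act (K Plus N0) (act x (act (K Minus N0) v))" for x v
    by (simp only: rep.arg_scale scale_scale cancel scale_one)
  have vanish: "free_eval scale borel_gen_op r v = 0" if "r \<in> borel_rels q" for r v
    using that unfolding borel_rels_def
  proof (elim insertE emptyE)
    assume r: "r = q_serre q bR bL"
    show ?thesis
      using serre[of N0 N1 v] unfolding r q_serre_def by (simp add: rep.rep_simps T.rep_simps gen)
  next
    assume r: "r = q_serre q bL bR"
    show ?thesis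
      using serre[of N1 N0 v] unfolding r q_serre_def by (simp add: rep.rep_simps T.rep_simps gen)
  next
    assume r: "r = bK Plus * bR * bK Minus - const (q powi 2) * bR"
    have "act (K Plus N0) (act (E Plus N0) (act (K Minus N0) v)) = scale (q powi 2) (act (E Plus N0) v)"
      using K0_E0[of Plus "act (K Minus N0) v"] by (simp add: K_inverse)
    then show ?thesis
      unfolding r T.rep_diff T.rep_mult T.rep_const gen(1,2) K conj by simp
  next
    assume r: "r = bK Plus * bL * bK Minus - const (q powi (- 2)) * bL"
    have "act (K Plus N0) (act (E Plus N1) (act (K Minus N0) v)) = scale (q powi (- 2)) (act (E Plus N1) v)"
      using K0_E1[of Plus "act (K Minus N0) v"] by (simp add: K_inverse)
    then show ?thesis
      unfolding r T.rep_diff T.rep_mult T.rep_const gen(1,2) K conj by simp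
  next
    assume r: "r = bK Plus * bK Minus - 1"
    show ?thesis
      unfolding r T.rep_diff T.rep_mult T.rep_one K
      by (simp only: rep.arg_scale scale_scale cancel scale_one K_inverse diff_self)
  next
    assume r: "r = bK Minus * bK Plus - 1"
    show ?thesis
      unfolding r T.rep_diff T.rep_mult T.rep_one K
      by (simp only: rep.arg_scale scale_scale cancel scale_one K_inverse diff_self)
  qed
  show ?thesis
  proof (rule module_structure_exists[OF vector_space_axioms borel_gen_op_linear])
    show "free_eval scale borel_gen_op r v = 0" if "r \<in> borel_rels q" for r v
      using that by (rule vanish)
    fix \<sigma>
    assume "module_structure scale (borel_rels q) \<sigma>"
      and "\<And>g. \<sigma> (residue_class (borel_rels q) (gen g)) = borel_gen_op g"
    then show ?thesis
      by (intro exI[of _ \<sigma>] conjI) (simp_all add: compatible_iff)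
  qed
qed

lemma compatible_structure_unique:
  assumes "module_structure scale (borel_rels q) \<sigma>" "compatible scale q \<epsilon>0 \<epsilon>1 \<alpha> \<rho> \<sigma>"
    and "module_structure scale (borel_rels q) \<tau>" "compatible scale q \<epsilon>0 \<epsilon>1 \<alpha> \<rho> \<tau>"
  shows "\<sigma> = \<tau>"
proof (rule module_structure_eqI[OF vector_space_axioms assms(1,3)])
  show "borel_op q \<sigma> (gen g) v = borel_op q \<tau> (gen g) v" for g v
    using assms compatible_iff by simp
qed

lemma compatible_structure_irreducible:
  assumes \<sigma>: "module_structure scale (borel_rels q) \<sigma>" "compatible scale q \<epsilon>0 \<epsilon>1 \<alpha> \<rho> \<sigma>"
  shows "irreducible_module scale (borel_rels q) \<sigma>"
  unfolding irreducible_module_def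
proof (intro conjI allI impI)
  show "module_structure scale (borel_rels q) \<sigma>" by (rule \<sigma>)
  show "(UNIV :: 'v set) \<noteq> {0}"
    using irreducible by (simp add: irreducible_module_def)
  fix W
  assume W: "subspace W \<and> (\<forall>A \<in> carrier (presented_algebra (borel_rels q)). \<sigma> A ` W \<subseteq> W)"
  then have inv: "borel_gen_op g v \<in> W" if "v \<in> W" for g v
    using that \<sigma> residue_class_in_carrier[of "borel_rels q" "gen g"] compatible_iff[OF \<sigma>(1)]
    by (metis image_subset_iff)
  show "W = {0} \<or> W = UNIV"
  proof (rule borel_invariant_subspace_trivial)
    show "subspace W" using W by blast
    fix v assume v: "v \<in> W"
    show "act (E Plus i) v \<in> W" for i
      using inv[OF v, of BorelR] inv[OF v, of BorelL] by (cases i) (simp_all add: borel_gen_op_def)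
    show "act (K s N0) v \<in> W" for s
    proof -
      have "scale (inverse (\<epsilon>0 * \<alpha> powi sgn_int s)) (borel_gen_op (BorelK s) v) \<in> W"
        using inv[OF v] W by (blast intro: subspace_scale)
      moreover have "\<epsilon>0 * \<alpha> powi sgn_int s \<noteq> 0"
        using \<epsilon>_square \<alpha> by auto
      ultimately show ?thesis
        by (simp add: borel_gen_op_def del: inverse_mult_distrib mult_eq_0_iff)
    qed
  qed
qed

lemma compatible_structure_type:
  assumes \<sigma>: "module_structure scale (borel_rels q) \<sigma>" "compatible scale q \<epsilon>0 \<epsilon>1 \<alpha> \<rho> \<sigma>"
  shows "borel_type scale q \<sigma> \<alpha>"
proof -
  let ?k = "act (K Plus N0)"
  obtain d :: nat where d: "eigenvalues scale ?k = {\<epsilon>0 * q powi (2 * int i - int d) | i. i \<le> d}"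
    using type unfolding uq_type_def by blast
  have K: "borel_op q \<sigma> (bK Plus) = (\<lambda>v. scale (\<epsilon>0 * \<alpha>) (?k v))"
    using \<sigma> compatible_iff by (simp add: borel_gen_op_def)
  have c: "\<epsilon>0 * \<alpha> \<noteq> 0"
    using \<epsilon>_square \<alpha> by auto
  have "eigenvalues scale (\<lambda>v. scale (\<epsilon>0 * \<alpha>) (?k v)) = (\<lambda>x. \<epsilon>0 * \<alpha> * x) ` eigenvalues scale ?k"
  proof (intro equalityI subsetI)
    fix x assume "x \<in> eigenvalues scale (\<lambda>v. scale (\<epsilon>0 * \<alpha>) (?k v))"
    then obtain v where v: "v \<noteq> 0" "scale (\<epsilon>0 * \<alpha>) (?k v) = scale x v"
      unfolding eigenvalues_def by blast
    have "?k v = scale (inverse (\<epsilon>0 * \<alpha>)) (scale (\<epsilon>0 * \<alpha>) (?k v))"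
      unfolding scale_scale left_inverse[OF c] by simp
    also have "\<dots> = scale (inverse (\<epsilon>0 * \<alpha>) * x) v"
      unfolding v(2) by simp
    finally have "inverse (\<epsilon>0 * \<alpha>) * x \<in> eigenvalues scale ?k"
      using v(1) unfolding eigenvalues_def by blast
    moreover have "x = \<epsilon>0 * \<alpha> * (inverse (\<epsilon>0 * \<alpha>) * x)"
      using c by (simp add: field_simps)
    ultimately show "x \<in> (\<lambda>x. \<epsilon>0 * \<alpha> * x) ` eigenvalues scale ?k"
      by blast
  qed (auto simp: eigenvalues_def)
  also have "\<dots> = {\<alpha> * q powi (2 * int i - int d) | i. i \<le> d}"
  proof -
    have "\<epsilon>0 * \<alpha> * (\<epsilon>0 * x) = \<alpha> * x" for x
      using \<epsilon>_square'(1) by (metis mult.assoc mult.commute)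
    then show ?thesis
      unfolding d by force
  qed
  finally show ?thesis
    unfolding borel_type_def K using \<alpha> by blast
qed

end

end

theorem theorem1p17:
  fixes q \<alpha> \<epsilon>0 \<epsilon>1 :: "'a::alg_closed_field"
    and scale :: "'a \<Rightarrow> 'v::ab_group_add \<Rightarrow> 'v"
    and B :: "'v set"
    and \<rho> :: "(uq_gen, 'a) free_algebra set \<Rightarrow> 'v \<Rightarrow> 'v"
  assumes "q \<noteq> 0"
    and "\<forall>n::nat. n > 0 \<longrightarrow> q ^ n \<noteq> 1"
    and "finite_dimensional_vector_space scale B"
    and "irreducible_module scale (uq_rels q) \<rho>"
    and "uq_type scale q \<rho> (\<epsilon>0, \<epsilon>1)"
    and "\<alpha> \<noteq> 0"
  shows "(\<exists>!\<sigma>. module_structure scale (borel_rels q) \<sigma> \<and> compatible scale q \<epsilon>0 \<epsilon>1 \<alpha> \<rho> \<sigma>) \<and>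
    (\<forall>\<sigma>. module_structure scale (borel_rels q) \<sigma> \<and> compatible scale q \<epsilon>0 \<epsilon>1 \<alpha> \<rho> \<sigma> \<longrightarrow>
       irreducible_module scale (borel_rels q) \<sigma> \<and> borel_type scale q \<sigma> \<alpha>)"
proof -
  interpret uq_irreducible_module scale B q \<epsilon>0 \<epsilon>1 \<rho>
    using assms by (simp add: uq_irreducible_module_def uq_irreducible_module_axioms_def)
  show ?thesis
    using compatible_structure_exists[OF \<open>\<alpha> \<noteq> 0\<close>] compatible_structure_unique[OF \<open>\<alpha> \<noteq> 0\<close>]
      compatible_structure_irreducible[OF \<open>\<alpha> \<noteq> 0\<close>] compatible_structure_type[OF \<open>\<alpha> \<noteq> 0\<close>]
    by blast
qed

end
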